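(* Let $G=(V,E)$ be a simple and connected graph with $n=|V|$ nodes and $m=|E|$ edges. Then the Ehrhart polynomial of the tocyclotope $\mathcal{Z}(A_G^{\triangle})$ is $$\mathrm{ehr}_{\mathcal{Z}(A_G^{\triangle})}(t)=\sum_{k=0}^{m-n+1} d_k\,t^k,$$ where $d_k$ is the number of edge sets of size $k$ in $G$ that are complements $E\setminus S$ of spanning sets $S\subseteq E$ of $G$. If $G$ is planar, then $d_k$ also equals the number of forests with $k$ edges in the dual graph $G^{\triangle}$.
   Context: Graphs are finite. Fix an arbitrary orientation of $G$; the incidence matrix $A_G\in\mathbb{Z}^{n\times m}$ has as column of an edge oriented between $j$ and $k$ the vector $\mathbf{e}_j-\mathbf{e}_k$ (up to sign, according to the orientation). A spanning set of a connected graph is a subset $S\subseteq E$ containing the edge set of a spanning tree. Choose a spanning tree of $G$ and order the edges so that the tree edges come last; by integral unimodular elementary row operations on $A_G$ that create one row of zeros, which is then discarded, one obtains a matrix $[W\mid I]\in\mathbb{Z}^{(n-1)\times m}$ (a network matrix of $G$), where $I$ is the identity matrix with columns corresponding to the tree edges. Set $A_G^{\triangle}=[I\mid -W^{\top}]\in\mathbb{Z}^{(m-n+1)\times m}$ (columns indexed by $E$ in the same order). For an integer matrix $A$ with $m$ columns, $\mathcal{Z}(A)=A[0,1]^m$; the tocyclotope of $G$ is $\mathcal{Z}(A_G^{\triangle})\subset\mathbb{R}^{m-n+1}$ (unique up to unimodular equivalence). The Ehrhart polynomial of a lattice polytope $\mathcal{P}\subset\mathbb{R}^d$ is the polynomial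 with $\mathrm{ehr}_{\mathcal P}(t)=|t\mathcal{P}\cap\mathbb{Z}^d|$ for positive integers $t$. For planar $G$, $G^{\triangle}$ is the planar dual graph (with respect to a planar embedding; it may have loops and multiple edges). *)

theory Defs
  imports "HOL-Analysis.Analysis" "HOL-Computational_Algebra.Polynomial"
    "Jordan_Normal_Form.Gauss_Jordan_Elimination"
begin

no_notation Finite_Cartesian_Product.vec_nth (infixl \<open>$\<close> 90)

text \<open>Multigraphs: the edge \<open>e\<close> joins the one (loop) or two vertices in \<open>ends G e\<close>.\<close>

record ('v, 'e) multigraph =
  verts :: "'v set"
  edges :: "'e set"
  ends :: "'e \<Rightarrow> 'v set"

definition edge_subgraph :: "('v, 'e) multigraph \<Rightarrow> 'e set \<Rightarrow> ('v, 'e) multigraph" where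
  "edge_subgraph G S = \<lparr>verts = verts G, edges = S, ends = ends G\<rparr>"

definition adj_rel :: "('v, 'e) multigraph \<Rightarrow> ('v \<times> 'v) set" where
  "adj_rel G = {(u, v). u \<in> verts G \<and> v \<in> verts G \<and> (\<exists>e\<in>edges G. ends G e = {u, v})}"

definition graph_connected :: "('v, 'e) multigraph \<Rightarrow> bool" where
  "graph_connected G \<longleftrightarrow>
     verts G \<noteq> {} \<and> (\<forall>u\<in>verts G. \<forall>v\<in>verts G. (u, v) \<in> (adj_rel G)\<^sup>*)"

text \<open>A cycle \<open>v\<^sub>0 e\<^sub>0 v\<^sub>1 e\<^sub>1 \<dots> e\<^sub>l v\<^sub>0\<close>. A loop is a cycle of length one, and two parallel edges
  form a cycle of length two.\<close>

definition is_cycle :: "('v, 'e) multigraph \<Rightarrow> 'v list \<Rightarrow> 'e list \<Rightarrow> bool" where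
  "is_cycle G xs es \<longleftrightarrow>
     es \<noteq> [] \<and> length xs = length es \<and> distinct xs \<and> distinct es \<and>
     set xs \<subseteq> verts G \<and> set es \<subseteq> edges G \<and>
     (\<forall>i<length es. ends G (es ! i) = {xs ! i, xs ! (Suc i mod length es)})"

definition is_forest :: "('v, 'e) multigraph \<Rightarrow> bool" where
  "is_forest G \<longleftrightarrow> (\<nexists>xs es. is_cycle G xs es)"

definition spanning_tree :: "('v, 'e) multigraph \<Rightarrow> 'e set \<Rightarrow> bool" where
  "spanning_tree G T \<longleftrightarrow>
     T \<subseteq> edges G \<and> graph_connected (edge_subgraph G T) \<and> is_forest (edge_subgraph G T)"

definition spanning_set :: "('v, 'e) multigraph \<Rightarrow> 'e set \<Rightarrow> bool" where
  "spanning_set G S \<longleftrightarrow> S \<subseteq> edges G \<and> (\<exists>T\<subseteq>S. spanning_tree G T)"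

definition num_spanning_complements :: "('v, 'e) multigraph \<Rightarrow> nat \<Rightarrow> nat" where
  "num_spanning_complements G k =
     card {D. card D = k \<and> (\<exists>S. spanning_set G S \<and> D = edges G - S)}"

definition num_forests :: "('v, 'e) multigraph \<Rightarrow> nat \<Rightarrow> nat" where
  "num_forests G k = card {S. S \<subseteq> edges G \<and> card S = k \<and> is_forest (edge_subgraph G S)}"

text \<open>A finite simple graph is given by its vertices and a set of two-element sets of vertices.\<close>

definition simple_graph :: "'a set \<Rightarrow> 'a set set \<Rightarrow> bool" where
  "simple_graph V E \<longleftrightarrow> finite V \<and> (\<forall>e\<in>E. e \<subseteq> V \<and> card e = 2)"

definition graph_of :: "'a set \<Rightarrow> 'a set set \<Rightarrow> ('a, 'a set) multigraph" where
  "graph_of V E = \<lparr>verts = V, edges = E, ends = (\<lambda>e. e)\<rparr>"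

definition orientation :: "'a set set \<Rightarrow> ('a set \<Rightarrow> 'a) \<Rightarrow> ('a set \<Rightarrow> 'a) \<Rightarrow> bool" where
  "orientation E src tgt \<longleftrightarrow> (\<forall>e\<in>E. e = {src e, tgt e})"

definition incidence_matrix ::
  "'a list \<Rightarrow> 'a set list \<Rightarrow> ('a set \<Rightarrow> 'a) \<Rightarrow> ('a set \<Rightarrow> 'a) \<Rightarrow> int mat" where
  "incidence_matrix vs es src tgt = mat (length vs) (length es) (\<lambda>(i, j).
     if vs ! i = src (es ! j) then 1 else if vs ! i = tgt (es ! j) then -1 else 0)"

inductive unimodular_row_ops :: "int mat \<Rightarrow> int mat \<Rightarrow> bool" for A where
  refl: "unimodular_row_ops A A"
| swap: "unimodular_row_ops A B \<Longrightarrow> k < dim_row B \<Longrightarrow> l < dim_row B \<Longrightarrow>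
    unimodular_row_ops A (swaprows k l B)"
| negate: "unimodular_row_ops A B \<Longrightarrow> k < dim_row B \<Longrightarrow>
    unimodular_row_ops A (multrow k (-1) B)"
| add: "unimodular_row_ops A B \<Longrightarrow> k < dim_row B \<Longrightarrow> l < dim_row B \<Longrightarrow> k \<noteq> l \<Longrightarrow>
    unimodular_row_ops A (addrow c k l B)"

definition delete_row :: "nat \<Rightarrow> 'b mat \<Rightarrow> 'b mat" where
  "delete_row r M =
     mat (dim_row M - 1) (dim_col M) (\<lambda>(i, j). M $$ (if i < r then i else Suc i, j))"

text \<open>The block matrix \<open>[A | B]\<close>.\<close>

definition beside :: "'b :: zero mat \<Rightarrow> 'b mat \<Rightarrow> 'b mat" where
  "beside A B = four_block_mat A B (0\<^sub>m 0 (dim_col A)) (0\<^sub>m 0 (dim_col B))"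

text \<open>\<open>[W | I]\<close> arises from \<open>A\<close> by unimodular row operations that create a zero row, which is
  discarded. The equation below forces \<open>W\<close> to have \<open>dim_row A - 1\<close> rows.\<close>

definition network_matrix :: "int mat \<Rightarrow> int mat \<Rightarrow> bool" where
  "network_matrix A W \<longleftrightarrow>
     (\<exists>M r. unimodular_row_ops A M \<and> r < dim_row M \<and> row M r = 0\<^sub>v (dim_col M) \<and>
        delete_row r M = beside W (1\<^sub>m (dim_row W)))"

definition dual_matrix :: "int mat \<Rightarrow> int mat" where
  "dual_matrix W = beside (1\<^sub>m (dim_col W)) (- transpose_mat W)"

definition zonotope :: "int mat \<Rightarrow> real vec set" where
  "zonotope A = {map_mat real_of_int A *\<^sub>v x | x.
     x \<in> carrier_vec (dim_col A) \<and> (\<forall>i<dim_col A. 0 \<le> x $ i \<and> x $ i \<le> 1)}"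

definition lattice_points :: "real vec set \<Rightarrow> real vec set" where
  "lattice_points P = {p \<in> P. \<forall>i<dim_vec p. p $ i \<in> \<int>}"

definition is_ehrhart_polynomial :: "real vec set \<Rightarrow> real poly \<Rightarrow> bool" where
  "is_ehrhart_polynomial P p \<longleftrightarrow>
     (\<forall>t::nat. t > 0 \<longrightarrow> finite (lattice_points ((\<lambda>v. real t \<cdot>\<^sub>v v) ` P)) \<and>
        poly p (real t) = real (card (lattice_points ((\<lambda>v. real t \<cdot>\<^sub>v v) ` P))))"

text \<open>Vertices are drawn as distinct points of the plane and edges as simple arcs that meet
  each other and the vertices only in common end points.\<close>

definition planar_embedding ::
  "'a set \<Rightarrow> 'a set set \<Rightarrow> ('a \<Rightarrow> complex) \<Rightarrow> ('a set \<Rightarrow> real \<Rightarrow> complex) \<Rightarrow> bool" where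
  "planar_embedding V E pos \<gamma> \<longleftrightarrow>
     inj_on pos V \<and>
     (\<forall>e\<in>E. arc (\<gamma> e) \<and> {pathstart (\<gamma> e), pathfinish (\<gamma> e)} = pos ` e \<and>
        path_image (\<gamma> e) \<inter> pos ` V = pos ` e) \<and>
     (\<forall>e\<in>E. \<forall>f\<in>E. e \<noteq> f \<longrightarrow> path_image (\<gamma> e) \<inter> path_image (\<gamma> f) = pos ` (e \<inter> f))"

definition faces ::
  "'a set \<Rightarrow> 'a set set \<Rightarrow> ('a \<Rightarrow> complex) \<Rightarrow> ('a set \<Rightarrow> real \<Rightarrow> complex) \<Rightarrow> complex set set" where
  "faces V E pos \<gamma> = components (- (pos ` V \<union> (\<Union>e\<in>E. path_image (\<gamma> e))))"

text \<open>The dual edge of \<open>e\<close> is again called \<open>e\<close>. It joins the faces whose boundary contains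
  the arc of \<open>e\<close>; it is a loop if there is only one such face.\<close>

definition dual_graph ::
  "'a set \<Rightarrow> 'a set set \<Rightarrow> ('a \<Rightarrow> complex) \<Rightarrow> ('a set \<Rightarrow> real \<Rightarrow> complex) \<Rightarrow>
    (complex set, 'a set) multigraph" where
  "dual_graph V E pos \<gamma> =
     \<lparr>verts = faces V E pos \<gamma>, edges = E,
      ends = (\<lambda>e. {F \<in> faces V E pos \<gamma>. path_image (\<gamma> e) \<subseteq> frontier F})\<rparr>"

end

theory Submission
  imports Defs
begin

text \<open>
  \<^bold>\<open>Ehrhart polynomial.\<close> Call a vector on the edges of the form
  \<open>e \<mapsto> \<phi> (src e) - \<phi> (tgt e)\<close> a tension. Row operations do not change the row space, so the
  rows of \<open>[W | I]\<close> span the space of tensions, which is also the kernel of \<open>[I | -W\<^sup>T]\<close>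
  (\<open>dual_matrix_kernel\<close>). A lattice point of the \<open>t\<close>-th
  dilate is the image of some \<open>x \<in> [0,t]\<^sup>E\<close>. It also has an integral preimage without bounds on the
  coordinates, because of the identity block, and the two preimages differ by a real tension with
  potential \<open>\<phi>\<close>. Replacing \<open>\<phi>\<close> by its floor preserves the bounds \<open>0\<close> and \<open>t\<close>, since these are
  integers (\<open>floor_shifted_bounds\<close>). Hence the lattice points correspond to the classes of
  \<open>{0..t}\<^sup>E\<close> modulo integral tensions.

  These classes are counted by a deletion-contraction recursion. Let \<open>N R C\<close> be the number of
  classes of vectors in \<open>{0..t}\<^sup>R\<close>, where two vectors are identified if they differ by a tension
  off \<open>C\<close>. Allow one more edge \<open>e\<close>. The classes that become equal once \<open>e\<close> is ignored as well form
  a line, and the classes that occur on such a line form an interval, because a potential can be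
  replaced by the indicator function of one of its upper level sets (\<open>unit_tension\<close>). The values
  \<open>0..t\<close> of the new coordinate lengthen every interval by \<open>t\<close>, so
  \<open>N (R + e) C = N R C + t * N R (C + e)\<close>, unless \<open>C + e\<close> supports a nonzero tension, in which case the
  new coordinate is redundant. Unfolding the recursion gives \<open>\<Sum> t ^ card S\<close> over all edge sets \<open>S\<close> that
  support no nonzero tension (\<open>card_tension_classes\<close>), and these are the sets with connected
  complement (\<open>tension_free_iff_connected\<close>).

  \<^bold>\<open>Planar duality.\<close> Both sides of the claim, that \<open>D\<close> is a forest of the dual graph and that
  \<open>E - D\<close> is connected, can be tested by inserting the edges of \<open>D\<close> one at a time. So it suffices that
  the ends of \<open>e\<close> are connected in \<open>E - D - e\<close> iff the dual ends of \<open>e\<close> are not connected in \<open>D\<close>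
  (\<open>reach_iff_not_dual_reach\<close>). Dual connectivity in \<open>D\<close> means lying in the same component of the
  complement of the drawing of \<open>E - D\<close>. If the ends of \<open>e\<close> are connected, a path closes the arc of
  \<open>e\<close> to a Jordan curve that separates the two sides of \<open>e\<close>; otherwise the arc joins two disjoint
  compact sets, and by Janiszewski's theorem it separates nothing. The same two cases show that an
  edge is on the boundary of one or two faces and that its whole arc lies on the boundary of each
  of them (\<open>edge_sides\<close>), although the arcs are merely continuous.
\<close>

section \<open>Connectivity and cycles in multigraphs\<close>

lemma adj_rel_edge_subgraph_graph_of:
  "adj_rel (edge_subgraph (graph_of V E) S) = {(u, v). u \<in> V \<and> v \<in> V \<and> {u, v} \<in> S}"
  by (auto simp: adj_rel_def edge_subgraph_def graph_of_def)

abbreviation reach :: "('v, 'e) multigraph \<Rightarrow> 'e set \<Rightarrow> ('v \<times> 'v) set" where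
  "reach G S \<equiv> (adj_rel (edge_subgraph G S))\<^sup>*"

lemma reach_sym: "(u, v) \<in> reach G S \<Longrightarrow> (v, u) \<in> reach G S"
proof -
  have "sym (adj_rel (edge_subgraph G S))"
    by (auto simp: sym_def adj_rel_def insert_commute)
  then show "(u, v) \<in> reach G S \<Longrightarrow> (v, u) \<in> reach G S"
    by (meson sym_rtrancl symD)
qed

lemma adj_rel_edge_subgraph:
  "(u, v) \<in> adj_rel (edge_subgraph G S) \<longleftrightarrow>
     u \<in> verts G \<and> v \<in> verts G \<and> (\<exists>e\<in>S. ends G e = {u, v})"
  by (simp add: adj_rel_def edge_subgraph_def)

lemma reach_mono: "S \<subseteq> T \<Longrightarrow> reach G S \<subseteq> reach G T"
  by (rule rtrancl_mono) (auto 4 4 simp: adj_rel_edge_subgraph)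

lemma reach_insert_redundant:
  assumes "(a, b) \<in> reach G S" "ends G e = {a, b}"
  shows "reach G (insert e S) = reach G S"
proof
  have "adj_rel (edge_subgraph G (insert e S)) \<subseteq> reach G S"
  proof (rule subrelI)
    fix u v assume "(u, v) \<in> adj_rel (edge_subgraph G (insert e S))"
    then have "{u, v} = {a, b} \<or> (u, v) \<in> adj_rel (edge_subgraph G S)"
      using assms(2) by (auto simp: adj_rel_edge_subgraph)
    then show "(u, v) \<in> reach G S"
      using assms(1) by (auto simp: doubleton_eq_iff intro: reach_sym)
  qed
  then show "reach G (insert e S) \<subseteq> reach G S" by (rule rtrancl_subset_rtrancl)
qed (auto intro: reach_mono[THEN subsetD])

lemma graph_connected_edge_subgraph:
  "graph_connected (edge_subgraph G S) \<longleftrightarrow> verts G \<noteq> {} \<and> (\<forall>u\<in>verts G. \<forall>v\<in>verts G. (u, v) \<in> reach G S)"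
  by (simp add: graph_connected_def) (simp add: edge_subgraph_def)

lemma graph_connected_mono:
  "graph_connected (edge_subgraph G S) \<Longrightarrow> S \<subseteq> T \<Longrightarrow> graph_connected (edge_subgraph G T)"
  using reach_mono[of S T G] by (auto simp: graph_connected_edge_subgraph)

lemma graph_connected_insert:
  assumes "ends G e = {a, b}" "a \<in> verts G" "b \<in> verts G"
  shows "graph_connected (edge_subgraph G S) \<longleftrightarrow>
    graph_connected (edge_subgraph G (insert e S)) \<and> (a, b) \<in> reach G S"
  using assms reach_insert_redundant[of a b G S e] graph_connected_mono[of G S "insert e S"]
  by (auto simp: graph_connected_edge_subgraph)

definition is_path :: "('v, 'e) multigraph \<Rightarrow> 'v list \<Rightarrow> 'e list \<Rightarrow> bool" where
  "is_path G xs es \<longleftrightarrow>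
     length xs = Suc (length es) \<and> distinct xs \<and> set xs \<subseteq> verts G \<and> set es \<subseteq> edges G \<and>
     (\<forall>i<length es. ends G (es ! i) = {xs ! i, xs ! Suc i})"

text \<open>A walk is extended edge by edge. If it returns to a vertex of the path built so far, the path is
  cut back to that vertex, so vertices never repeat.\<close>

lemma rtrancl_adj_rel_imp_path:
  assumes "(u, v) \<in> (adj_rel G)\<^sup>*" "u \<in> verts G"
  obtains xs es where "is_path G xs es" "xs ! 0 = u" "xs ! length es = v"
proof -
  have "\<exists>xs es. is_path G xs es \<and> xs ! 0 = u \<and> xs ! length es = v"
    using assms(1)
  proof (induction rule: rtrancl_induct)
    case base
    show ?case
      by (rule exI[of _ "[u]"], rule exI[of _ "[]"]) (use assms(2) in \<open>simp add: is_path_def\<close>)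
  next
    case (step v w)
    then obtain xs es where p: "is_path G xs es" "xs ! 0 = u" "xs ! length es = v" by blast
    from step.hyps(2) obtain e where e: "e \<in> edges G" "ends G e = {v, w}" "w \<in> verts G"
      by (auto simp: adj_rel_def)
    show ?case
    proof (cases "w \<in> set xs")
      case True
      then obtain i where i: "i < length xs" "xs ! i = w" by (auto simp: in_set_conv_nth)
      have "is_path G (take (Suc i) xs) (take i es)"
        using p(1) i set_take_subset[of "Suc i" xs] set_take_subset[of i es]
        by (auto simp: is_path_def)
      moreover have "take (Suc i) xs ! 0 = u" "take (Suc i) xs ! length (take i es) = w"
        using p i by (auto simp: is_path_def less_Suc_eq_le min_absorb2)
      ultimately show ?thesis by blast
    next
      case False
      have "is_path G (xs @ [w]) (es @ [e])"
        using p False e by (auto simp: is_path_def nth_append less_Suc_eq)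
      moreover have "(xs @ [w]) ! 0 = u" "(xs @ [w]) ! length (es @ [e]) = w"
        using p by (auto simp: is_path_def nth_append)
      ultimately show ?thesis by blast
    qed
  qed
  then show thesis using that by blast
qed

lemma is_path_distinct_edges:
  assumes "is_path G xs es" shows "distinct es"
proof (unfold distinct_conv_nth, intro allI impI)
  fix i j assume ij: "i < length es" "j < length es" "i \<noteq> j"
  have "xs ! k = xs ! l \<longleftrightarrow> k = l" if "k \<le> length es" "l \<le> length es" for k l
    using assms that by (simp add: is_path_def nth_eq_iff_index_eq)
  then have "{xs ! i, xs ! Suc i} \<noteq> {xs ! j, xs ! Suc j}"
    using ij by (auto simp: doubleton_eq_iff)
  then show "es ! i \<noteq> es ! j"
    using assms ij by (metis is_path_def)
qed

lemma path_closed_by_edge_is_cycle: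
  assumes "is_path (edge_subgraph G S) xs es" "xs ! 0 = u" "xs ! length es = v"
    and "ends G e = {u, v}" "e \<notin> S"
  shows "is_cycle (edge_subgraph G (insert e S)) xs (es @ [e])"
proof -
  have "Suc i mod Suc (length es) = Suc i" if "i < length es" for i
    using that by simp
  then show ?thesis
    using assms is_path_distinct_edges[OF assms(1)]
    by (auto simp: is_cycle_def is_path_def edge_subgraph_def nth_append less_Suc_eq insert_commute
        simp del: mod_Suc)
qed

text \<open>The rest of the cycle joins the ends of \<open>e\<close> the other way round.\<close>

lemma cycle_minus_edge_reach:
  assumes cyc: "is_cycle (edge_subgraph G S) xs es" and "e \<in> set es" "ends G e = {u, v}"
  shows "(u, v) \<in> reach G (S - {e})"
proof -
  let ?l = "length es"
  obtain k where k: "k < ?l" "es ! k = e"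
    using assms(2) by (auto simp: in_set_conv_nth)
  have c: "length xs = ?l" "distinct es" "set xs \<subseteq> verts G" "set es \<subseteq> S"
    "\<And>i. i < ?l \<Longrightarrow> ends G (es ! i) = {xs ! i, xs ! (Suc i mod ?l)}"
    using cyc by (auto simp: is_cycle_def edge_subgraph_def)
  have around: "(xs ! (Suc k mod ?l), xs ! ((Suc k + j) mod ?l)) \<in> reach G (S - {e})" if "j < ?l" for j
    using that
  proof (induction j)
    case (Suc j)
    let ?i = "(Suc k + j) mod ?l"
    have i: "?i < ?l" by (rule mod_less_divisor) (use k in auto)
    have "?i \<noteq> k"
    proof
      assume "?i = k"
      then have "(Suc k + j) mod ?l = k mod ?l" using k by simp
      then have "?l dvd Suc k + j - k" by (meson le_add1 mod_eq_dvd_iff_nat add_leD1 le_SucI trans_le_add1 le_refl)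
      then have "?l dvd Suc j" by simp
      with Suc.prems show False by (auto dest: dvd_imp_le)
    qed
    then have "es ! ?i \<noteq> e" using i k c(2) by (simp add: nth_eq_iff_index_eq flip: k(2))
    then have "es ! ?i \<in> S - {e}" using i c(4) by auto
    moreover have "Suc ?i mod ?l < ?l" by (rule mod_less_divisor) (use k in auto)
    with i c(1) have "xs ! ?i \<in> verts G" "xs ! (Suc ?i mod ?l) \<in> verts G"
      by (auto intro!: subsetD[OF c(3)] nth_mem simp del: mod_Suc)
    ultimately have "(xs ! ?i, xs ! (Suc ?i mod ?l)) \<in> adj_rel (edge_subgraph G (S - {e}))"
      using c(5)[OF i] by (auto simp: adj_rel_edge_subgraph)
    moreover have "Suc ?i mod ?l = (Suc k + Suc j) mod ?l"
      by (simp add: mod_Suc_eq)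
    ultimately show ?case
      using Suc by (auto intro: rtrancl_into_rtrancl)
  qed auto
  have "Suc k + (?l - 1) = k + ?l" using k(1) by linarith
  then have "(Suc k + (?l - 1)) mod ?l = k" using k(1) by simp
  with around[of "?l - 1"] k have "(xs ! (Suc k mod ?l), xs ! k) \<in> reach G (S - {e})"
    by simp
  moreover have "{u, v} = {xs ! k, xs ! (Suc k mod ?l)}" using c(5)[OF k(1)] k(2) assms(3) by simp
  ultimately show ?thesis
    by (auto simp: doubleton_eq_iff intro: reach_sym)
qed

text \<open>The criterion by which forests are grown edge by edge: a cycle through the new edge is the same as
  a path between its ends. It covers loops, where \<open>u = v\<close>.\<close>

lemma is_forest_insert:
  assumes "ends G e = {u, v}" "u \<in> verts G" "e \<notin> S"
  shows "is_forest (edge_subgraph G (insert e S)) \<longleftrightarrow> is_forest (edge_subgraph G S) \<and> (u, v) \<notin> reach G S"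
proof
  assume forest: "is_forest (edge_subgraph G (insert e S))"
  have "is_cycle (edge_subgraph G (insert e S)) xs es" if "is_cycle (edge_subgraph G S) xs es" for xs es
    using that by (auto simp: is_cycle_def edge_subgraph_def)
  then have "is_forest (edge_subgraph G S)" using forest by (auto simp: is_forest_def)
  moreover have "(u, v) \<notin> reach G S"
  proof
    assume "(u, v) \<in> reach G S"
    moreover have "u \<in> verts (edge_subgraph G S)" using assms(2) by (simp add: edge_subgraph_def)
    ultimately obtain xs es where "is_path (edge_subgraph G S) xs es" "xs ! 0 = u" "xs ! length es = v"
      by (rule rtrancl_adj_rel_imp_path)
    from path_closed_by_edge_is_cycle[OF this assms(1,3)] forest show False
      by (auto simp: is_forest_def)
  qed
  ultimately show "is_forest (edge_subgraph G S) \<and> (u, v) \<notin> reach G S" by simp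
next
  assume R: "is_forest (edge_subgraph G S) \<and> (u, v) \<notin> reach G S"
  show "is_forest (edge_subgraph G (insert e S))"
    unfolding is_forest_def
  proof (intro notI, elim exE)
    fix xs es assume cyc: "is_cycle (edge_subgraph G (insert e S)) xs es"
    show False
    proof (cases "e \<in> set es")
      case True
      from cycle_minus_edge_reach[OF cyc this assms(1)] R assms(3) show False by simp
    next
      case False
      then have "is_cycle (edge_subgraph G S) xs es"
        using cyc by (auto simp: is_cycle_def edge_subgraph_def)
      with R show False by (auto simp: is_forest_def)
    qed
  qed
qed

text \<open>A smallest connected subset is a tree: an edge on a cycle could be removed without disconnecting
  the graph.\<close>

lemma spanning_set_iff_connected:
  assumes "finite (edges G)"
  shows "spanning_set G S \<longleftrightarrow> S \<subseteq> edges G \<and> graph_connected (edge_subgraph G S)"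
proof
  assume "spanning_set G S"
  then show "S \<subseteq> edges G \<and> graph_connected (edge_subgraph G S)"
    by (auto simp: spanning_set_def spanning_tree_def intro: graph_connected_mono)
next
  assume S: "S \<subseteq> edges G \<and> graph_connected (edge_subgraph G S)"
  define T where "T = arg_min card (\<lambda>T. T \<subseteq> S \<and> graph_connected (edge_subgraph G T))"
  have T: "T \<subseteq> S" "graph_connected (edge_subgraph G T)"
    using arg_min_natI[of "\<lambda>T. T \<subseteq> S \<and> graph_connected (edge_subgraph G T)" S card] S
    by (auto simp: T_def)
  have min: "card T \<le> card U" if "U \<subseteq> S" "graph_connected (edge_subgraph G U)" for U
    unfolding T_def using that by (intro arg_min_nat_le) auto
  have "finite T" using T(1) S assms by (meson finite_subset subset_trans)
  have "is_forest (edge_subgraph G T)"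
    unfolding is_forest_def
  proof (intro notI, elim exE)
    fix xs es assume cyc: "is_cycle (edge_subgraph G T) xs es"
    then have c: "es \<noteq> []" "length xs = length es" "set xs \<subseteq> verts G" "set es \<subseteq> T"
      "ends G (es ! 0) = {xs ! 0, xs ! (Suc 0 mod length es)}"
      by (auto simp: is_cycle_def edge_subgraph_def)
    let ?e = "es ! 0"
    have e: "?e \<in> set es" "?e \<in> T" using c(1,4) by auto
    have v: "xs ! 0 \<in> verts G" "xs ! (Suc 0 mod length es) \<in> verts G"
    proof -
      have "0 < length xs" "Suc 0 mod length es < length xs"
        unfolding c(2) using c(1) mod_less_divisor[of "length es" "Suc 0"] by blast+
      then show "xs ! 0 \<in> verts G" "xs ! (Suc 0 mod length es) \<in> verts G"
        using c(3) nth_mem by blast+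
    qed
    have "graph_connected (edge_subgraph G (T - {?e}))"
      unfolding graph_connected_insert[OF c(5) v, of "T - {?e}"]
      using T(2) e(2) cycle_minus_edge_reach[OF cyc e(1) c(5)] by (simp add: insert_absorb)
    then have "card T \<le> card (T - {?e})" using T(1) by (intro min) auto
    then show False using e(2) \<open>finite T\<close> by (metis card_Diff1_less leD)
  qed
  then show "spanning_set G S"
    using S T by (auto simp: spanning_set_def spanning_tree_def)
qed

lemma num_spanning_complements_eq:
  assumes "finite (edges G)"
  shows "num_spanning_complements G k =
    card {D. D \<subseteq> edges G \<and> graph_connected (edge_subgraph G (edges G - D)) \<and> card D = k}"
proof -
  have "(\<exists>S. spanning_set G S \<and> D = edges G - S) \<longleftrightarrow>
      D \<subseteq> edges G \<and> graph_connected (edge_subgraph G (edges G - D))" for D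
    unfolding spanning_set_iff_connected[OF assms]
    by (metis Diff_subset double_diff subset_refl)
  then show ?thesis unfolding num_spanning_complements_def by (metis (no_types, lifting))
qed

text \<open>A set of vertices is grown one vertex at a time. As long as it is not everything, some edge of \<open>S\<close>
  leaves it, and that edge is new because the earlier edges lie inside. This bounds the degree of
  the Ehrhart polynomial.\<close>

lemma connected_card_verts_le:
  assumes con: "graph_connected (edge_subgraph G S)" and "finite S" "finite (verts G)"
  shows "card (verts G) \<le> Suc (card S)"
proof -
  have grow: "\<exists>A T. A \<subseteq> verts G \<and> T \<subseteq> S \<and> card A = Suc k \<and> card T = k \<and> (\<forall>e\<in>T. ends G e \<subseteq> A)"
    if "k < card (verts G)" for k
    using that
  proof (induction k)
    case 0
    from con obtain v where "v \<in> verts G" by (auto simp: graph_connected_edge_subgraph)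
    then show ?case by (intro exI[of _ "{v}"] exI[of _ "{}"]) auto
  next
    case (Suc k)
    then obtain A T where A: "A \<subseteq> verts G" "T \<subseteq> S" "card A = Suc k" "card T = k" "\<forall>e\<in>T. ends G e \<subseteq> A"
      by auto
    then obtain u where u: "u \<in> A" by (metis card_eq_SucD insertI1)
    have "A \<noteq> verts G" using A Suc.prems by auto
    then obtain v where v: "v \<in> verts G" "v \<notin> A" using A(1) by auto
    have "(u, v) \<in> reach G S" using con u v A(1) by (auto simp: graph_connected_edge_subgraph)
    then have "\<exists>x y. (x, y) \<in> adj_rel (edge_subgraph G S) \<and> x \<in> A \<and> y \<notin> A"
      using u v(2) by (induction rule: rtrancl_induct) auto
    then obtain x y e where e: "e \<in> S" "ends G e = {x, y}" "x \<in> A" "y \<notin> A" "y \<in> verts G"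
      by (auto simp: adj_rel_edge_subgraph)
    have "e \<notin> T" using A(5) e by auto
    have fin: "finite A" "finite T"
      using finite_subset[OF A(1) assms(3)] finite_subset[OF A(2) assms(2)] by auto
    show ?case
      by (intro exI[of _ "insert y A"] exI[of _ "insert e T"]) (use A e fin \<open>e \<notin> T\<close> in auto)
  qed
  moreover have "card (verts G) > 0"
    using con \<open>finite (verts G)\<close> by (simp add: graph_connected_edge_subgraph card_gt_0_iff)
  ultimately obtain T where "T \<subseteq> S" "card T = card (verts G) - 1"
    using grow[of "card (verts G) - 1"] by force
  with card_mono[OF assms(2), of T] show ?thesis by simp
qed

section \<open>Attaching an arc to a compact set in the plane\<close>

text \<open>An arc has empty interior by invariance of dimension: its inverse would embed an open subset of
  the plane into the line.\<close>

lemma closure_compl_arc: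
  fixes g :: "real \<Rightarrow> complex"
  assumes "arc g"
  shows "closure (- path_image g) = UNIV"
proof -
  have "interior (path_image g) = {}"
  proof (rule ccontr)
    assume ne: "interior (path_image g) \<noteq> {}"
    obtain h where h: "homeomorphism {0..1} (path_image g) g h"
      using assms homeomorphism_arc by blast
    then have "continuous_on (path_image g) h" "inj_on h (path_image g)"
      by (auto simp: homeomorphism_def intro: inj_on_inverseI)
    then have "DIM(complex) \<le> DIM(real)"
      using ne interior_subset[of "path_image g"]
      by (intro invariance_of_dimension[of "interior (path_image g)" h])
        (auto intro: continuous_on_subset inj_on_subset)
    then show False by simp
  qed
  then show ?thesis by (simp add: closure_complement)
qed

text \<open>An arc that meets two disjoint compact sets in one point each does not separate their
  complement any further. Janiszewski's theorem applies twice, first attaching the arc to \<open>Y1\<close> and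
  then \<open>Y2\<close> to the result; each time the intersection is a single point.\<close>

lemma connected_component_compl_bridge:
  fixes g :: "real \<Rightarrow> complex"
  assumes "compact Y1" "compact Y2" "Y1 \<inter> Y2 = {}" "arc g"
    and "path_image g \<inter> Y1 = {a}" "path_image g \<inter> Y2 = {b}"
    and pq: "connected_component (- (Y1 \<union> Y2)) p q" "p \<notin> path_image g" "q \<notin> path_image g"
  shows "connected_component (- (Y1 \<union> Y2 \<union> path_image g)) p q"
proof -
  have arc: "compact (path_image g)" "connected (- path_image g)"
    using assms(4) by (auto simp: connected_arc_complement compact_arc_image)
  have "connected_component (- (Y1 \<union> path_image g)) p q"
  proof (rule Janiszewski)
    show "connected_component (- Y1) p q"
      using pq(1) by (rule connected_component_of_subset) auto
    show "connected_component (- path_image g) p q"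
      using arc(2) pq(2,3) by (auto simp: connected_iff_connected_component)
  qed (use assms arc in \<open>auto simp: compact_imp_closed Int_commute\<close>)
  then have "connected_component (- ((Y1 \<union> path_image g) \<union> Y2)) p q"
  proof (rule Janiszewski[rotated 3])
    show "connected_component (- Y2) p q"
      using pq(1) by (rule connected_component_of_subset) auto
    have "(Y1 \<union> path_image g) \<inter> Y2 = {b}" using assms by auto
    then show "connected ((Y1 \<union> path_image g) \<inter> Y2)" by simp
  qed (use assms arc in \<open>auto simp: compact_imp_closed compact_Un\<close>)
  then show ?thesis by (simp add: ac_simps)
qed

text \<open>The arc \<open>g\<close> joins two points that the arc \<open>h\<close> already joins inside \<open>Y\<close>. Adding \<open>g\<close> to \<open>Y\<close> separates
  exactly the inside \<open>I\<close> from the outside \<open>Q\<close> of the Jordan curve formed by \<open>g\<close> and \<open>h\<close>: this curve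
  meets \<open>Y\<close> in the connected set \<open>h\<close>, so by Janiszewski's theorem two points on the same side of it
  are not separated by \<open>Y \<union> g\<close> unless \<open>Y\<close> separates them.\<close>

lemma arc_closes_Jordan_curve:
  fixes g :: "real \<Rightarrow> complex"
  assumes "compact Y" "arc g" "arc h" "path_image h \<subseteq> Y"
    and "pathstart h = pathfinish g" "pathfinish h = pathstart g"
    and gY: "path_image g \<inter> Y = {pathstart g, pathfinish g}"
  obtains I Q where "open I" "open Q" "I \<inter> Q = {}" "I \<union> Q = - (path_image g \<union> path_image h)"
    "path_image g \<subseteq> closure I" "path_image g \<subseteq> closure Q"
    "\<forall>p q. connected_component (- Y) p q \<longrightarrow> p \<in> I \<and> q \<in> I \<or> p \<in> Q \<and> q \<in> Q \<longrightarrow>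
       connected_component (- (Y \<union> path_image g)) p q"
proof -
  let ?J = "path_image (g +++ h)"
  have loop: "simple_path (g +++ h)" "pathfinish (g +++ h) = pathstart (g +++ h)"
    using assms by (auto intro!: simple_path_join_loop)
  have J: "?J = path_image g \<union> path_image h"
    using assms by (simp add: path_image_join)
  note jio = Jordan_inside_outside[OF loop]
  have "path_image g \<inter> Y \<subseteq> path_image h"
    using pathstart_in_path_image[of h] pathfinish_in_path_image[of h] assms(5,6) gY by simp
  then have "Y \<inter> ?J = path_image h"
    using assms(4) J by blast
  moreover have "connected (path_image h)"
    using assms(3) by (simp add: arc_imp_path connected_path_image)
  ultimately have con: "connected (Y \<inter> ?J)" by simp
  have "connected_component (- (Y \<union> path_image g)) p q"
    if "connected_component (- Y) p q" and
      "p \<in> inside ?J \<and> q \<in> inside ?J \<or> p \<in> outside ?J \<and> q \<in> outside ?J" for p q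
  proof -
    have "connected_component (- ?J) p q"
    proof -
      have "inside ?J \<subseteq> - ?J" "outside ?J \<subseteq> - ?J" using jio by blast+
      with that(2) jio show ?thesis
        by (metis connected_component_of_subset connected_iff_connected_component)
    qed
    then have "connected_component (- (Y \<union> ?J)) p q"
      using that(1) con assms(1) loop(1)
      by (intro Janiszewski) (auto simp: closed_path_image simple_path_imp_path)
    moreover have "Y \<union> ?J = Y \<union> path_image g"
      using assms(4) J by auto
    ultimately show ?thesis by simp
  qed
  moreover have "path_image g \<subseteq> closure (inside ?J)" "path_image g \<subseteq> closure (outside ?J)"
    using jio J by (auto simp: frontier_def)
  ultimately show thesis
    using jio J by (intro that[of "inside ?J" "outside ?J"]) blast+
qed

section \<open>Duality of plane graphs\<close>

locale plane_graph =
  fixes V :: "'a set" and E :: "'a set set"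
    and pos :: "'a \<Rightarrow> complex" and \<gamma> :: "'a set \<Rightarrow> real \<Rightarrow> complex"
  assumes simple: "simple_graph V E" and embedding: "planar_embedding V E pos \<gamma>"
begin

definition drawing :: "'a set set \<Rightarrow> complex set" where
  "drawing S = pos ` V \<union> (\<Union>e\<in>S. path_image (\<gamma> e))"

definition open_arc :: "'a set \<Rightarrow> complex set" where
  "open_arc e = path_image (\<gamma> e) - pos ` e"

lemma finite_V: "finite V" and finite_E: "finite E"
proof -
  show "finite V" using simple by (simp add: simple_graph_def)
  moreover have "E \<subseteq> Pow V" using simple by (auto simp: simple_graph_def)
  ultimately show "finite E" by (meson finite_Pow_iff finite_subset)
qed

lemma edge_subset: "e \<in> E \<Longrightarrow> e \<subseteq> V"
  using simple by (auto simp: simple_graph_def)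

lemma edge_ends:
  assumes "e \<in> E"
  obtains a b where "e = {a, b}" "a \<noteq> b" "a \<in> V" "b \<in> V"
    "pathstart (\<gamma> e) = pos a" "pathfinish (\<gamma> e) = pos b"
proof -
  have "card e = 2" "e \<subseteq> V" using assms simple by (auto simp: simple_graph_def)
  then obtain a b where ab: "e = {a, b}" "a \<noteq> b" by (meson card_2_iff)
  have "{pathstart (\<gamma> e), pathfinish (\<gamma> e)} = {pos a, pos b}"
    using embedding assms ab by (auto simp: planar_embedding_def)
  then consider "pathstart (\<gamma> e) = pos a" "pathfinish (\<gamma> e) = pos b"
    | "pathstart (\<gamma> e) = pos b" "pathfinish (\<gamma> e) = pos a"
    by (auto simp: doubleton_eq_iff)
  then show thesis
    using that[of a b] that[of b a] ab \<open>e \<subseteq> V\<close> by cases (auto simp: insert_commute)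
qed

lemma arc_edge: "e \<in> E \<Longrightarrow> arc (\<gamma> e)"
  and ends_edge: "e \<in> E \<Longrightarrow> {pathstart (\<gamma> e), pathfinish (\<gamma> e)} = pos ` e"
  and edge_vertices: "e \<in> E \<Longrightarrow> path_image (\<gamma> e) \<inter> pos ` V = pos ` e"
  and edges_meet: "e \<in> E \<Longrightarrow> f \<in> E \<Longrightarrow> e \<noteq> f \<Longrightarrow>
    path_image (\<gamma> e) \<inter> path_image (\<gamma> f) = pos ` (e \<inter> f)"
  and inj_pos: "inj_on pos V"
  using embedding by (auto simp: planar_embedding_def)

lemma compact_edge: "e \<in> E \<Longrightarrow> compact (path_image (\<gamma> e))"
  by (simp add: arc_edge compact_arc_image)

lemma compact_partial_drawing:
  assumes "A \<subseteq> V" "S \<subseteq> E"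
  shows "compact (pos ` A \<union> (\<Union>e\<in>S. path_image (\<gamma> e)))"
proof (intro compact_Un compact_UN)
  show "compact (pos ` A)"
    using assms(1) finite_V by (meson finite_imageI finite_imp_compact finite_subset)
qed (use assms(2) finite_subset[OF _ finite_E] compact_edge in auto)

lemma compact_drawing: "S \<subseteq> E \<Longrightarrow> compact (drawing S)"
  unfolding drawing_def by (rule compact_partial_drawing) auto

lemma drawing_insert: "drawing (insert e S) = drawing S \<union> path_image (\<gamma> e)"
  by (auto simp: drawing_def)

lemma drawing_mono: "S \<subseteq> T \<Longrightarrow> drawing S \<subseteq> drawing T"
  by (auto simp: drawing_def)

lemma edge_Int_drawing:
  assumes "e \<in> E" "S \<subseteq> E" "e \<notin> S"
  shows "path_image (\<gamma> e) \<inter> drawing S = pos ` e"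
proof -
  have "path_image (\<gamma> e) \<inter> path_image (\<gamma> f) \<subseteq> pos ` e" if "f \<in> S" for f
    using edges_meet[of e f] that assms by auto
  then show ?thesis
    using edge_vertices[OF assms(1)] by (auto simp: drawing_def)
qed

lemma open_arc_disjoint_drawing:
  "e \<in> E \<Longrightarrow> S \<subseteq> E \<Longrightarrow> e \<notin> S \<Longrightarrow> open_arc e \<inter> drawing S = {}"
  using edge_Int_drawing[of e S] unfolding open_arc_def by blast

lemma open_arc_eq: "e \<in> E \<Longrightarrow> open_arc e = \<gamma> e ` {0<..<1}"
proof -
  assume e: "e \<in> E"
  have inj: "inj_on (\<gamma> e) {0..1}" using arc_edge[OF e] by (simp add: arc_def)
  have "open_arc e = \<gamma> e ` {0..1} - \<gamma> e ` {0, 1}"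
    using ends_edge[OF e] by (auto simp: open_arc_def path_image_def pathstart_def pathfinish_def)
  also have "\<dots> = \<gamma> e ` ({0..1} - {0, 1})"
    using inj by (subst inj_on_image_set_diff[of _ "{0..1}"]) auto
  also have "{0..1} - {0, 1::real} = {0<..<1}" by auto
  finally show ?thesis .
qed

lemma connected_open_arc:
  assumes e: "e \<in> E" shows "connected (open_arc e)"
proof -
  have "continuous_on {0<..<1} (\<gamma> e)"
    using arc_imp_path[OF arc_edge[OF e]] unfolding path_def
    by (rule continuous_on_subset) auto
  then show ?thesis
    by (simp add: open_arc_eq[OF e] connected_continuous_image)
qed

lemma edge_subset_closure_open_arc:
  assumes e: "e \<in> E" shows "path_image (\<gamma> e) \<subseteq> closure (open_arc e)"
proof -
  have "continuous_on (closure {0<..<1}) (\<gamma> e)"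
    using arc_imp_path[OF arc_edge[OF e]] by (simp add: path_def)
  then have "\<gamma> e ` closure {0<..<1} \<subseteq> closure (\<gamma> e ` {0<..<1})"
    by (rule image_closure_subset) (auto simp: closure_subset)
  then show ?thesis by (simp add: open_arc_eq[OF e] path_image_def)
qed

lemma open_compl_drawing: "S \<subseteq> E \<Longrightarrow> open (- drawing S)"
  by (simp add: compact_drawing compact_imp_closed open_Compl)

lemma reach_imp_path_component:
  assumes "(a, b) \<in> reach (graph_of V E) S" "S \<subseteq> E" "a \<in> V"
  shows "path_component (drawing S) (pos a) (pos b)"
  using assms(1)
proof (induction rule: rtrancl_induct)
  case base
  then show ?case using assms(3) by (auto simp: drawing_def intro: path_component_refl)
next
  case (step b c)
  then have bc: "{b, c} \<in> S" "b \<in> V" "c \<in> V"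
    by (auto simp: adj_rel_edge_subgraph_graph_of)
  then have e: "{b, c} \<in> E" using assms(2) by auto
  have "path_connected (path_image (\<gamma> {b, c}))"
    using arc_edge[OF e] by (simp add: arc_imp_path path_connected_path_image)
  moreover have "pos b \<in> path_image (\<gamma> {b, c})" "pos c \<in> path_image (\<gamma> {b, c})"
    using edge_vertices[OF e] by auto
  ultimately have "path_component (path_image (\<gamma> {b, c})) (pos b) (pos c)"
    by (simp add: path_connected_component)
  then have "path_component (drawing S) (pos b) (pos c)"
    by (rule path_component_of_subset[rotated]) (use bc in \<open>auto simp: drawing_def\<close>)
  with step.IH show ?case by (rule path_component_trans)
qed

text \<open>A walk in the graph is drawn as a path, and the image of a path contains an arc with the same ends.\<close>

lemma reach_imp_arc:
  assumes "(a, b) \<in> reach (graph_of V E) S" "S \<subseteq> E" "a \<in> V" "b \<in> V" "a \<noteq> b"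
  obtains h where "arc h" "path_image h \<subseteq> drawing S" "pathstart h = pos a" "pathfinish h = pos b"
proof -
  obtain p where p: "path p" "path_image p \<subseteq> drawing S" "pathstart p = pos a" "pathfinish p = pos b"
    using reach_imp_path_component[OF assms(1-3)] by (auto simp: path_component_def)
  have "pos a \<noteq> pos b" using inj_on_contraD[OF inj_pos] assms by simp
  from path_contains_arc[OF p(1,3,4) this] obtain h
    where "arc h" "path_image h \<subseteq> path_image p" "pathstart h = pos a" "pathfinish h = pos b" .
  with p(2) show thesis by (intro that[of h]) auto
qed

text \<open>The drawing splits into the part reached from \<open>a\<close> and the rest; no edge of \<open>S\<close> joins the two.\<close>

lemma not_reach_imp_separated:
  assumes "(a, b) \<notin> reach (graph_of V E) S" "S \<subseteq> E" "a \<in> V" "b \<in> V"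
  obtains Y1 Y2 where "compact Y1" "compact Y2" "Y1 \<inter> Y2 = {}" "drawing S = Y1 \<union> Y2"
    "pos a \<in> Y1" "pos b \<in> Y2"
proof -
  define A where "A = {v \<in> V. (a, v) \<in> reach (graph_of V E) S}"
  define S1 where "S1 = {f\<in>S. f \<inter> A \<noteq> {}}"
  define S2 where "S2 = {f\<in>S. f \<inter> A = {}}"
  define Y1 where "Y1 = pos ` A \<union> (\<Union>f\<in>S1. path_image (\<gamma> f))"
  define Y2 where "Y2 = pos ` (V - A) \<union> (\<Union>f\<in>S2. path_image (\<gamma> f))"
  have sub: "f \<subseteq> A" if "f \<in> S1" for f
  proof -
    from that assms(2) have "f \<in> E" by (auto simp: S1_def)
    then obtain c d where "f = {c, d}" "c \<in> V" "d \<in> V" by (rule edge_ends)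
    then have "(c, d) \<in> adj_rel (edge_subgraph (graph_of V E) S)"
      "(d, c) \<in> adj_rel (edge_subgraph (graph_of V E) S)"
      using that by (auto simp: adj_rel_edge_subgraph_graph_of insert_commute S1_def)
    then have "c \<in> A \<Longrightarrow> d \<in> A" "d \<in> A \<Longrightarrow> c \<in> A"
      using \<open>c \<in> V\<close> \<open>d \<in> V\<close> unfolding A_def by (auto elim: rtrancl_into_rtrancl)
    with that \<open>f = {c, d}\<close> show ?thesis by (auto simp: S1_def)
  qed
  have AV: "A \<subseteq> V" by (auto simp: A_def)
  have "compact Y1" "compact Y2"
    unfolding Y1_def Y2_def using AV assms(2)
    by (auto intro!: compact_partial_drawing simp: S1_def S2_def)
  moreover have "Y1 \<inter> Y2 = {}"
  proof -
    have 1: "pos ` A \<inter> pos ` (V - A) = {}" using inj_pos AV by (auto simp: inj_on_def)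
    have 2: "pos ` A \<inter> path_image (\<gamma> f) = {}" if "f \<in> S2" for f
    proof -
      have "f \<in> E" "f \<subseteq> V" using that assms(2) edge_subset by (auto simp: S2_def)
      have "pos ` A \<inter> path_image (\<gamma> f) \<subseteq> pos ` A \<inter> (path_image (\<gamma> f) \<inter> pos ` V)"
        using AV by auto
      also have "\<dots> = pos ` (A \<inter> f)"
        using inj_on_image_Int[OF inj_pos AV \<open>f \<subseteq> V\<close>] edge_vertices[OF \<open>f \<in> E\<close>] by simp
      also have "\<dots> = {}" using that by (auto simp: S2_def)
      finally show ?thesis by simp
    qed
    have 3: "pos ` (V - A) \<inter> path_image (\<gamma> f) = {}" if "f \<in> S1" for f
    proof -
      have "f \<in> E" "f \<subseteq> A" using that assms(2) sub by (auto simp: S1_def)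
      have "pos ` (V - A) \<inter> path_image (\<gamma> f) \<subseteq> pos ` (V - A) \<inter> (path_image (\<gamma> f) \<inter> pos ` V)"
        by auto
      also have "\<dots> \<subseteq> pos ` (V - A) \<inter> pos ` A"
        unfolding edge_vertices[OF \<open>f \<in> E\<close>] using \<open>f \<subseteq> A\<close> by auto
      finally show ?thesis using 1 by auto
    qed
    have 4: "path_image (\<gamma> f) \<inter> path_image (\<gamma> g) = {}"
      if "f \<in> S1" "g \<in> S2" for f g
    proof -
      have "f \<inter> g = {}" using sub that unfolding S1_def S2_def by blast
      moreover have "f \<noteq> g" "f \<in> E" "g \<in> E" using that assms(2) by (auto simp: S1_def S2_def)
      ultimately show ?thesis using edges_meet[of f g] by simp
    qed
    have "pos ` A \<inter> (\<Union>f\<in>S2. path_image (\<gamma> f)) = {}"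
      "(\<Union>f\<in>S1. path_image (\<gamma> f)) \<inter> pos ` (V - A) = {}"
      "(\<Union>f\<in>S1. path_image (\<gamma> f)) \<inter> (\<Union>f\<in>S2. path_image (\<gamma> f)) = {}"
      using 2 3 4 by blast+
    with 1 show ?thesis unfolding Y1_def Y2_def Int_Un_distrib Int_Un_distrib2 by simp
  qed
  moreover have "drawing S = Y1 \<union> Y2"
  proof -
    have "V = A \<union> (V - A)" "S = S1 \<union> S2" using AV by (auto simp: S1_def S2_def)
    then have "drawing S = pos ` (A \<union> (V - A)) \<union> (\<Union>e\<in>S1 \<union> S2. path_image (\<gamma> e))"
      by (simp add: drawing_def)
    then show ?thesis unfolding Y1_def Y2_def image_Un Union_Un_distrib by (simp only: Un_ac)
  qed
  moreover have "pos a \<in> Y1" "pos b \<in> Y2"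
  proof -
    have "a \<in> A" "b \<in> V - A" using assms by (simp_all add: A_def)
    then show "pos a \<in> Y1" "pos b \<in> Y2" by (simp_all add: Y1_def Y2_def)
  qed
  ultimately show thesis by (rule that)
qed

text \<open>The face that contains the open arc of \<open>e\<close> after \<open>e\<close> has been erased. The midpoint is an arbitrary
  choice of a point of this open arc.\<close>

definition region :: "'a set \<Rightarrow> complex set" where
  "region e = connected_component_set (- drawing (E - {e})) (\<gamma> e (1/2))"

abbreviation dual :: "(complex set, 'a set) multigraph" where
  "dual \<equiv> dual_graph V E pos \<gamma>"

lemma faces_eq: "faces V E pos \<gamma> = components (- drawing E)"
  by (simp add: faces_def drawing_def)

lemma ends_dual: "ends dual e = {F \<in> components (- drawing E). path_image (\<gamma> e) \<subseteq> frontier F}"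
  by (simp add: dual_graph_def faces_eq)

lemma midpoint_in_open_arc: "e \<in> E \<Longrightarrow> \<gamma> e (1/2) \<in> open_arc e"
  by (simp add: open_arc_eq)

lemma open_region: "open (region e)"
  unfolding region_def by (intro open_connected_component open_compl_drawing) auto

lemma region_subset: "region e \<subseteq> - drawing (E - {e})"
  unfolding region_def by (rule connected_component_subset)

lemma connected_component_region:
  "p \<in> region e \<Longrightarrow> q \<in> region e \<Longrightarrow> connected_component (- drawing (E - {e})) p q"
  unfolding region_def by (metis connected_component_sym connected_component_trans mem_Collect_eq)

lemma open_arc_subset_region: "e \<in> E \<Longrightarrow> open_arc e \<subseteq> region e"
  unfolding region_def
  by (intro connected_component_maximal midpoint_in_open_arc connected_open_arc)
    (use open_arc_disjoint_drawing[of e "E - {e}"] in auto)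

lemma drawing_remove: "e \<in> E \<Longrightarrow> drawing E = drawing (E - {e}) \<union> path_image (\<gamma> e)"
  using drawing_insert[of e "E - {e}"] by (simp add: insert_absorb)

lemma closure_side:
  assumes "e \<in> E" "path_image (\<gamma> e) \<subseteq> closure X"
  shows "path_image (\<gamma> e) \<subseteq> closure (region e \<inter> X)"
proof -
  have "open_arc e \<subseteq> region e \<inter> closure X"
    using assms open_arc_subset_region by (auto simp: open_arc_def)
  also have "\<dots> \<subseteq> closure (region e \<inter> X)"
    by (rule open_Int_closure_subset) (rule open_region)
  finally have "closure (open_arc e) \<subseteq> closure (region e \<inter> X)"
    by (rule closure_minimal) simp
  with edge_subset_closure_open_arc[OF assms(1)] show ?thesis by (rule order_trans)
qed

text \<open>Putting \<open>e\<close> back divides its region into at most two parts, the sides of \<open>e\<close>, and each side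
  touches the whole arc. If the ends of \<open>e\<close> are connected by other edges, the sides are cut out by a
  Jordan curve through \<open>e\<close>. If \<open>e\<close> is a bridge, both sides coincide.\<close>

lemma edge_sides:
  assumes e: "e \<in> E"
  obtains A1 A2 where "region e - path_image (\<gamma> e) = A1 \<union> A2"
    "path_image (\<gamma> e) \<subseteq> closure A1" "path_image (\<gamma> e) \<subseteq> closure A2"
    "\<forall>p\<in>A1. \<forall>q\<in>A1. connected_component (- drawing E) p q"
    "\<forall>p\<in>A2. \<forall>q\<in>A2. connected_component (- drawing E) p q"
proof -
  let ?Y = "drawing (E - {e})"
  obtain a b where ab: "e = {a, b}" "a \<noteq> b" "a \<in> V" "b \<in> V"
    "pathstart (\<gamma> e) = pos a" "pathfinish (\<gamma> e) = pos b"
    using e by (rule edge_ends)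
  have Int: "path_image (\<gamma> e) \<inter> ?Y = {pos a, pos b}"
    using edge_Int_drawing[of e "E - {e}"] e ab(1) by auto
  show thesis
  proof (cases "(a, b) \<in> reach (graph_of V E) (E - {e})")
    case True
    then have "(b, a) \<in> reach (graph_of V E) (E - {e})" by (rule reach_sym)
    then obtain h where h: "arc h" "path_image h \<subseteq> ?Y" "pathstart h = pos b" "pathfinish h = pos a"
      using ab by (elim reach_imp_arc) auto
    obtain I Q where IQ: "open I" "open Q" "I \<inter> Q = {}" "I \<union> Q = - (path_image (\<gamma> e) \<union> path_image h)"
      "path_image (\<gamma> e) \<subseteq> closure I" "path_image (\<gamma> e) \<subseteq> closure Q"
      and con: "\<forall>p q. connected_component (- ?Y) p q \<longrightarrow> p \<in> I \<and> q \<in> I \<or> p \<in> Q \<and> q \<in> Q \<longrightarrow>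
       connected_component (- (?Y \<union> path_image (\<gamma> e))) p q"
      by (rule arc_closes_Jordan_curve[OF compact_drawing[OF Diff_subset] arc_edge[OF e] h(1,2)])
        (use h ab(5,6) Int in auto)
    have con': "connected_component (- drawing E) p q"
      if "p \<in> region e" "q \<in> region e" "p \<in> I \<and> q \<in> I \<or> p \<in> Q \<and> q \<in> Q" for p q
      unfolding drawing_remove[OF e]
      using con that connected_component_region by blast
    show thesis
    proof (rule that[of "region e \<inter> I" "region e \<inter> Q"])
      show "region e - path_image (\<gamma> e) = region e \<inter> I \<union> region e \<inter> Q"
        using IQ(4) region_subset[of e] h(2) by blast
      show "path_image (\<gamma> e) \<subseteq> closure (region e \<inter> I)" "path_image (\<gamma> e) \<subseteq> closure (region e \<inter> Q)"
        using closure_side[OF e] IQ(5,6) by blast+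
    qed (use con' in blast)+
  next
    case False
    then obtain Y1 Y2 where Y: "compact Y1" "compact Y2" "Y1 \<inter> Y2 = {}" "?Y = Y1 \<union> Y2"
      "pos a \<in> Y1" "pos b \<in> Y2"
      using ab by (elim not_reach_imp_separated) auto
    have Int': "path_image (\<gamma> e) \<inter> Y1 = {pos a}" "path_image (\<gamma> e) \<inter> Y2 = {pos b}"
      using Int Y by auto
    have *: "connected_component (- drawing E) p q"
      if "p \<in> region e - path_image (\<gamma> e)" "q \<in> region e - path_image (\<gamma> e)" for p q
      using connected_component_compl_bridge[OF Y(1-3) arc_edge[OF e] Int', of p q]
        connected_component_region[of p e q] that Y(4) drawing_remove[OF e] by auto
    have "path_image (\<gamma> e) \<subseteq> closure (region e - path_image (\<gamma> e))"
      unfolding Diff_eq using closure_compl_arc[OF arc_edge[OF e]] by (intro closure_side[OF e]) auto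
    with * show thesis by (intro that[of "region e - path_image (\<gamma> e)" "region e - path_image (\<gamma> e)"]) auto
  qed
qed

lemma face_of_side_in_ends:
  assumes e: "e \<in> E" and p: "p \<in> region e - path_image (\<gamma> e)"
  shows "connected_component_set (- drawing E) p \<in> ends dual e"
proof -
  let ?F = "connected_component_set (- drawing E) p"
  obtain A1 A2 where A: "region e - path_image (\<gamma> e) = A1 \<union> A2"
    "path_image (\<gamma> e) \<subseteq> closure A1" "path_image (\<gamma> e) \<subseteq> closure A2"
    "\<forall>p\<in>A1. \<forall>q\<in>A1. connected_component (- drawing E) p q"
    "\<forall>p\<in>A2. \<forall>q\<in>A2. connected_component (- drawing E) p q"
    by (rule edge_sides[OF e])
  from p A(1) consider "p \<in> A1" | "p \<in> A2" by blast
  then have "path_image (\<gamma> e) \<subseteq> closure ?F"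
  proof cases
    case 1
    then have "A1 \<subseteq> ?F" using A(4) by blast
    from A(2) closure_mono[OF this] show ?thesis by (rule order_trans)
  next
    case 2
    then have "A2 \<subseteq> ?F" using A(5) by blast
    from A(3) closure_mono[OF this] show ?thesis by (rule order_trans)
  qed
  moreover have "interior ?F \<inter> path_image (\<gamma> e) = {}"
    using interior_subset[of ?F] connected_component_subset[of "- drawing E" p] drawing_remove[OF e]
    by blast
  moreover have "p \<in> - drawing E"
    using p region_subset[of e] drawing_remove[OF e] by auto
  ultimately show ?thesis
    by (auto simp: ends_dual frontier_def componentsI)
qed

lemma end_subset_region:
  assumes e: "e \<in> E" and F: "F \<in> ends dual e"
  shows "F \<subseteq> region e - path_image (\<gamma> e)"
proof -
  have F': "F \<in> components (- drawing E)" "path_image (\<gamma> e) \<subseteq> closure F"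
    using F by (auto simp: ends_dual frontier_def)
  have mid: "\<gamma> e (1/2) \<in> region e" "\<gamma> e (1/2) \<in> path_image (\<gamma> e)"
    using midpoint_in_open_arc[OF e] open_arc_subset_region[OF e] by (auto simp: open_arc_def)
  then have "region e \<inter> F \<noteq> {}"
    using F'(2) open_region[of e] by (metis disjoint_iff open_Int_closure_eq_empty subsetD)
  moreover have "F \<subseteq> - drawing E" "connected F"
    using F'(1) by (auto dest: in_components_subset in_components_connected)
  moreover have "region e \<in> components (- drawing (E - {e}))"
    unfolding region_def using mid region_subset[of e] by (auto intro: componentsI)
  ultimately have "F \<subseteq> region e"
    using components_maximal[of "region e" "- drawing (E - {e})" F] drawing_remove[OF e] by auto
  with \<open>F \<subseteq> - drawing E\<close> show ?thesis using drawing_remove[OF e] by auto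
qed

lemma component_eq:
  "F \<in> components (- drawing E) \<Longrightarrow> p \<in> F \<Longrightarrow> F = connected_component_set (- drawing E) p"
  by (metis componentsE connected_component_eq)

lemma dual_edge_ends:
  assumes e: "e \<in> E"
  obtains F1 F2 where "F1 \<in> components (- drawing E)" "F2 \<in> components (- drawing E)" "ends dual e = {F1, F2}"
proof -
  obtain A1 A2 where A: "region e - path_image (\<gamma> e) = A1 \<union> A2"
    "path_image (\<gamma> e) \<subseteq> closure A1" "path_image (\<gamma> e) \<subseteq> closure A2"
    "\<forall>p\<in>A1. \<forall>q\<in>A1. connected_component (- drawing E) p q"
    "\<forall>p\<in>A2. \<forall>q\<in>A2. connected_component (- drawing E) p q"
    by (rule edge_sides[OF e])
  have "A1 \<noteq> {}" "A2 \<noteq> {}"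
    using A(2,3) path_image_nonempty[of "\<gamma> e"] by auto
  then obtain p1 p2 where p: "p1 \<in> A1" "p2 \<in> A2" by auto
  let ?F = "connected_component_set (- drawing E)"
  have in_ends: "?F p1 \<in> ends dual e" "?F p2 \<in> ends dual e"
    using A(1) p by (auto intro: face_of_side_in_ends[OF e])
  moreover have "F = ?F p1 \<or> F = ?F p2" if F: "F \<in> ends dual e" for F
  proof -
    have Fc: "F \<in> components (- drawing E)" using F by (simp add: ends_dual)
    then obtain r where r: "r \<in> F" using in_components_nonempty by blast
    then have "r \<in> A1 \<union> A2" using end_subset_region[OF e F] A(1) by auto
    then have "connected_component (- drawing E) p1 r \<or> connected_component (- drawing E) p2 r"
      using A(4,5) p by auto
    then show ?thesis
      using component_eq[OF Fc r] connected_component_eq by blast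
  qed
  ultimately have "ends dual e = {?F p1, ?F p2}" by auto
  moreover from in_ends have "?F p1 \<in> components (- drawing E)" "?F p2 \<in> components (- drawing E)"
    by (simp_all add: ends_dual)
  ultimately show thesis using that by blast
qed

lemma region_subset_ends:
  assumes e: "e \<in> E"
  shows "region e \<subseteq> \<Union> (ends dual e) \<union> open_arc e"
proof
  fix p assume p: "p \<in> region e"
  show "p \<in> \<Union> (ends dual e) \<union> open_arc e"
  proof (cases "p \<in> path_image (\<gamma> e)")
    case True
    moreover have "p \<notin> pos ` e"
      using p region_subset[of e] edge_subset[OF e] by (auto simp: drawing_def)
    ultimately show ?thesis by (simp add: open_arc_def)
  next
    case False
    then have "p \<in> - drawing E"
      using p region_subset[of e] drawing_remove[OF e] by auto
    then have "p \<in> connected_component_set (- drawing E) p"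
      by simp
    with False p show ?thesis
      using face_of_side_in_ends[OF e, of p] by blast
  qed
qed

lemma open_arc_disjoint_face: "e \<in> E \<Longrightarrow> F \<in> components (- drawing E) \<Longrightarrow> open_arc e \<inter> F = {}"
  using in_components_subset[of F "- drawing E"] drawing_remove[of e] unfolding open_arc_def by blast

lemma open_arcs_disjoint: "e \<in> E \<Longrightarrow> f \<in> E \<Longrightarrow> e \<noteq> f \<Longrightarrow> open_arc e \<inter> open_arc f = {}"
  using edges_meet[of e f] unfolding open_arc_def by blast

text \<open>One passes from a face to a neighbour through the midpoint of the erased edge \<open>e \<in> D\<close> between
  them, which lies in the closure of both.\<close>

lemma dual_reach_imp_connected:
  assumes "(F1, F2) \<in> reach dual D" "F1 \<in> components (- drawing E)" "D \<subseteq> E" "p \<in> F1" "q \<in> F2"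
  shows "connected_component (- drawing (E - D)) p q"
  using assms(1,5)
proof (induction arbitrary: q rule: rtrancl_induct)
  case base
  have "F1 \<subseteq> - drawing (E - D)"
    using in_components_subset[OF assms(2)] drawing_mono[of "E - D" E] by auto
  moreover have "connected F1" using assms(2) by (rule in_components_connected)
  ultimately show ?case using assms(4) base by (auto simp: connected_component_def)
next
  case (step F F')
  obtain e where e: "e \<in> D" "ends dual e = {F, F'}"
    using step.hyps(2) by (auto simp: adj_rel_def edge_subgraph_def)
  then have eE: "e \<in> E" using assms(3) by auto
  let ?z = "\<gamma> e (1/2)"
  have F: "F \<in> components (- drawing E)" "F' \<in> components (- drawing E)"
    "path_image (\<gamma> e) \<subseteq> closure F" "path_image (\<gamma> e) \<subseteq> closure F'"
    using e(2) by (auto simp: ends_dual frontier_def)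
  have z: "?z \<in> path_image (\<gamma> e)" "?z \<notin> drawing (E - D)"
    using midpoint_in_open_arc[OF eE] open_arc_disjoint_drawing[OF eE, of "E - D"] e(1)
    by (auto simp: open_arc_def)
  have con: "connected (insert ?z A)" "insert ?z A \<subseteq> - drawing (E - D)"
    if "A \<in> components (- drawing E)" "path_image (\<gamma> e) \<subseteq> closure A" for A
  proof -
    show "connected (insert ?z A)"
      by (rule connected_intermediate_closure[OF in_components_connected[OF that(1)]])
        (use that(2) z(1) closure_subset[of A] in auto)
    show "insert ?z A \<subseteq> - drawing (E - D)"
      using in_components_subset[OF that(1)] drawing_mono[of "E - D" E] z(2) by auto
  qed
  obtain r where r: "r \<in> F" using in_components_nonempty[OF F(1)] by auto
  have "connected_component (- drawing (E - D)) p r" by (rule step.IH[OF r])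
  moreover have "connected_component (- drawing (E - D)) r ?z"
    using con[OF F(1,3)] r by (auto simp: connected_component_def)
  moreover have "connected_component (- drawing (E - D)) ?z q"
    using con[OF F(2,4)] step.prems by (auto simp: connected_component_def)
  ultimately show ?case by (meson connected_component_trans)
qed

text \<open>The faces reached from \<open>F1\<close>, together with the regions of the erased edges between them, form an open
  set \<open>side A\<close>. The other faces and erased edges form an open set \<open>side B\<close>. Every dual edge of \<open>D\<close> has
  both ends in \<open>A\<close> or both in \<open>B\<close>, so these open sets are disjoint and cover the complement of the
  drawing of \<open>E - D\<close>; they therefore disconnect it between \<open>F1\<close> and any face that is not reached.\<close>

lemma connected_imp_dual_reach:
  assumes con: "connected_component (- drawing (E - D)) p q" and D: "D \<subseteq> E"
    and F: "F1 \<in> components (- drawing E)" "F2 \<in> components (- drawing E)" "p \<in> F1" "q \<in> F2"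
  shows "(F1, F2) \<in> reach dual D"
proof (rule ccontr)
  assume nreach: "(F1, F2) \<notin> reach dual D"
  define A where "A = {F \<in> components (- drawing E). (F1, F) \<in> reach dual D}"
  define B where "B = components (- drawing E) - A"
  \<comment> \<open>A region consists of the faces at its edge and one open arc. So \<open>side X \<subseteq> skel X\<close>, and disjointness can be seen from the parts of \<open>skel\<close>.\<close>
  define side where "side X = \<Union> X \<union> (\<Union>e\<in>{e\<in>D. ends dual e \<subseteq> X}. region e)" for X
  define arcs where "arcs X = (\<Union>e\<in>{e\<in>D. ends dual e \<subseteq> X}. open_arc e)" for X
  define skel where "skel X = \<Union> X \<union> arcs X" for X
  have dich: "ends dual e \<subseteq> A \<or> ends dual e \<subseteq> B" if "e \<in> D" for e
  proof -
    from that D have "e \<in> E" by auto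
    then obtain G1 G2 where G: "G1 \<in> components (- drawing E)" "G2 \<in> components (- drawing E)"
      "ends dual e = {G1, G2}" by (rule dual_edge_ends)
    then have "(G1, G2) \<in> adj_rel (edge_subgraph dual D)" "(G2, G1) \<in> adj_rel (edge_subgraph dual D)"
      using that by (auto simp: adj_rel_def edge_subgraph_def dual_graph_def faces_eq insert_commute)
    then have "G1 \<in> A \<longleftrightarrow> G2 \<in> A"
      using G(1,2) unfolding A_def by (auto elim: rtrancl_into_rtrancl)
    then show ?thesis using G unfolding B_def by simp
  qed
  have ne: "ends dual e \<noteq> {}" if "e \<in> D" for e
  proof -
    from that D have "e \<in> E" by auto
    then obtain G1 G2 where "ends dual e = {G1, G2}" by (rule dual_edge_ends)
    then show ?thesis by simp
  qed
  have op: "open (side X)" if "X \<subseteq> components (- drawing E)" for X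
    unfolding side_def
    by (intro open_Un open_Union open_UN ballI open_region)
      (use that open_components[OF open_compl_drawing[of E]] in auto)
  have side_skel: "side X \<subseteq> skel X" for X
    using region_subset_ends D unfolding side_def skel_def arcs_def by blast
  have disj: "skel A \<inter> skel B = {}"
  proof -
    have AB: "A \<subseteq> components (- drawing E)" "B \<subseteq> components (- drawing E)" "A \<inter> B = {}"
      by (auto simp: A_def B_def)
    have "\<Union> A \<inter> \<Union> B = {}"
      using AB components_nonoverlap[of _ "- drawing E"] by blast
    moreover have "\<Union> X \<inter> arcs Y = {}" if "X \<subseteq> components (- drawing E)" for X Y
      using open_arc_disjoint_face that D unfolding arcs_def by blast
    moreover have "open_arc e \<inter> open_arc f = {}" if "e \<in> D" "f \<in> D" "ends dual e \<subseteq> A" "ends dual f \<subseteq> B" for e f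
    proof -
      have "e \<noteq> f" using that AB(3) ne[OF that(1)] by blast
      then show ?thesis using open_arcs_disjoint that D by blast
    qed
    ultimately have "\<Union> A \<inter> \<Union> B = {}" "\<Union> A \<inter> arcs B = {}" "\<Union> B \<inter> arcs A = {}" "arcs A \<inter> arcs B = {}"
      using AB(1,2) unfolding arcs_def by blast+
    then show ?thesis unfolding skel_def by blast
  qed
  have cover: "- drawing (E - D) \<subseteq> side A \<union> side B"
  proof
    fix x assume x: "x \<in> - drawing (E - D)"
    show "x \<in> side A \<union> side B"
    proof (cases "x \<in> drawing E")
      case False
      then have "x \<in> \<Union> (components (- drawing E))"
        using Union_components[of "- drawing E"] by blast
      then obtain F where "F \<in> components (- drawing E)" "x \<in> F" by blast
      then show ?thesis unfolding side_def B_def by blast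
    next
      case True
      with x obtain e where e: "e \<in> E" "e \<in> D" "x \<in> path_image (\<gamma> e)" "x \<notin> pos ` V"
        by (auto simp: drawing_def)
      then have "x \<in> open_arc e" using edge_subset[OF e(1)] by (auto simp: open_arc_def)
      then have "x \<in> region e" using open_arc_subset_region[OF e(1)] by auto
      then show ?thesis using dich[OF e(2)] e(2) unfolding side_def by blast
    qed
  qed
  let ?C = "connected_component_set (- drawing (E - D)) p"
  have "?C \<subseteq> - drawing (E - D)" by (rule connected_component_subset)
  then have "?C \<subseteq> side A \<union> side B" using cover by blast
  moreover have "side A \<inter> side B \<inter> ?C = {}" using disj side_skel by blast
  moreover have "p \<in> side A \<inter> ?C"
  proof -
    have "F1 \<in> A" using F(1) by (simp add: A_def)
    moreover have "connected_component (- drawing (E - D)) p p"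
      using con connected_component_refl connected_component_in by blast
    ultimately show ?thesis using F(3) by (auto simp: side_def)
  qed
  moreover have "q \<in> side B \<inter> ?C"
  proof -
    have "F2 \<in> B" using F(2) nreach by (simp add: A_def B_def)
    then show ?thesis using F(4) con by (auto simp: side_def)
  qed
  moreover have "open (side A)" "open (side B)"
    by (auto intro!: op simp: A_def B_def)
  ultimately show False
    using connectedD[of ?C "side A" "side B"] connected_connected_component by blast
qed

text \<open>The heart of planar duality. If \<open>e\<close> lies on a cycle that avoids \<open>D\<close>, this cycle is a Jordan curve that
  separates the two faces at \<open>e\<close> even after \<open>D\<close> is erased. Otherwise the arc of \<open>e\<close> joins two components
  of the drawing of \<open>E - D - e\<close>, and its two sides stay connected.\<close>

lemma reach_iff_not_dual_reach:
  assumes e: "e = {a, b}" "e \<in> E" "e \<notin> D" "D \<subseteq> E" and F: "ends dual e = {F1, F2}"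
  shows "(a, b) \<in> reach (graph_of V E) (E - insert e D) \<longleftrightarrow> (F1, F2) \<notin> reach dual D"
proof -
  let ?S = "E - insert e D"
  obtain u v where uv: "e = {u, v}" "u \<noteq> v" "u \<in> V" "v \<in> V"
    "pathstart (\<gamma> e) = pos u" "pathfinish (\<gamma> e) = pos v"
    using e(2) by (rule edge_ends)
  have ab_uv: "(a, b) \<in> reach (graph_of V E) ?S \<longleftrightarrow> (u, v) \<in> reach (graph_of V E) ?S"
    using uv(1) e(1) by (auto simp: doubleton_eq_iff intro: reach_sym)
  have insD: "insert e ?S = E - D" using e by auto
  then have dED: "drawing (E - D) = drawing ?S \<union> path_image (\<gamma> e)"
    using drawing_insert[of e ?S] by simp
  have Int: "path_image (\<gamma> e) \<inter> drawing ?S = {pos u, pos v}"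
    using edge_Int_drawing[of e ?S] e uv(1) by auto
  have F': "F1 \<in> components (- drawing E)" "F2 \<in> components (- drawing E)"
    using F by (auto simp: ends_dual)
  show ?thesis
  proof (cases "(u, v) \<in> reach (graph_of V E) ?S")
    case True
    then have "(v, u) \<in> reach (graph_of V E) ?S" by (rule reach_sym)
    then obtain h where h: "arc h" "path_image h \<subseteq> drawing ?S" "pathstart h = pos v" "pathfinish h = pos u"
      by (rule reach_imp_arc[OF _ Diff_subset uv(4,3) uv(2)[symmetric]])
    obtain I Q where IQ: "open I" "open Q" "I \<inter> Q = {}" "I \<union> Q = - (path_image (\<gamma> e) \<union> path_image h)"
      "path_image (\<gamma> e) \<subseteq> closure I" "path_image (\<gamma> e) \<subseteq> closure Q"
      "\<forall>p q. connected_component (- drawing ?S) p q \<longrightarrow> p \<in> I \<and> q \<in> I \<or> p \<in> Q \<and> q \<in> Q \<longrightarrow>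
         connected_component (- (drawing ?S \<union> path_image (\<gamma> e))) p q"
      by (rule arc_closes_Jordan_curve[OF compact_drawing[OF Diff_subset] arc_edge[OF e(2)] h(1,2)])
        (simp_all add: h uv(5,6) Int)
    have "region e \<inter> I \<noteq> {}" "region e \<inter> Q \<noteq> {}"
      using closure_side[OF e(2) IQ(5)] closure_side[OF e(2) IQ(6)] path_image_nonempty[of "\<gamma> e"] by auto
    then obtain p q where pq: "p \<in> region e" "p \<in> I" "q \<in> region e" "q \<in> Q" by auto
    have notarc: "p \<notin> path_image (\<gamma> e)" "q \<notin> path_image (\<gamma> e)"
      using pq IQ(4) by auto
    let ?F = "connected_component_set (- drawing E)"
    have ends: "?F p \<in> ends dual e" "?F q \<in> ends dual e"
      using face_of_side_in_ends[OF e(2)] pq notarc by auto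
    have "p \<in> - drawing E" "q \<in> - drawing E"
      using pq notarc region_subset[of e] drawing_remove[OF e(2)] by auto
    then have mem: "p \<in> ?F p" "q \<in> ?F q" by simp_all
    have "(F1, F2) \<notin> reach dual D"
    proof
      assume "(F1, F2) \<in> reach dual D"
      then have "(?F p, ?F q) \<in> reach dual D"
        using ends reach_sym unfolding F by auto
      then have "connected_component (- drawing (E - D)) p q"
        using ends mem by (intro dual_reach_imp_connected[OF _ _ e(4)]) (auto simp: ends_dual)
      then obtain C where C: "connected C" "C \<subseteq> - drawing (E - D)" "p \<in> C" "q \<in> C"
        by (auto simp: connected_component_def)
      have "C \<subseteq> I \<union> Q" using C(2) IQ(4) h(2) unfolding dED by blast
      then show False
        using connectedD[OF C(1) IQ(1,2)] IQ(3) pq C(3,4) by blast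
    qed
    with True ab_uv show ?thesis by simp
  next
    case False
    then obtain Y1 Y2 where Y: "compact Y1" "compact Y2" "Y1 \<inter> Y2 = {}" "drawing ?S = Y1 \<union> Y2"
      "pos u \<in> Y1" "pos v \<in> Y2"
      by (rule not_reach_imp_separated[OF _ Diff_subset uv(3,4)])
    have Int': "path_image (\<gamma> e) \<inter> Y1 = {pos u}" "path_image (\<gamma> e) \<inter> Y2 = {pos v}"
      using Int Y by auto
    obtain p q where pq: "p \<in> F1" "q \<in> F2" using F' in_components_nonempty by blast
    then have *: "p \<in> region e - path_image (\<gamma> e)" "q \<in> region e - path_image (\<gamma> e)"
      using end_subset_region[OF e(2), of F1] end_subset_region[OF e(2), of F2] by (auto simp: F)
    then have "connected_component (- drawing (E - {e})) p q"
      by (intro connected_component_region) simp_all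
    then have "connected_component (- (Y1 \<union> Y2)) p q"
      by (rule connected_component_of_subset)
        (unfold Y(4)[symmetric], use drawing_mono[of ?S "E - {e}"] in blast)
    then have "connected_component (- drawing (E - D)) p q"
      using connected_component_compl_bridge[OF Y(1-3) arc_edge[OF e(2)] Int', of p q] *
      unfolding dED Y(4) by blast
    then have "(F1, F2) \<in> reach dual D"
      by (rule connected_imp_dual_reach) (use e F' pq in auto)
    with False ab_uv show ?thesis by simp
  qed
qed

text \<open>Induction on \<open>D\<close>: a new edge keeps the dual forest acyclic iff its dual ends were not yet connected,
  and keeps the complement connected iff its ends are connected by the remaining edges.\<close>

lemma dual_forest_iff_complement_connected:
  assumes con: "graph_connected (graph_of V E)" and "D \<subseteq> E"
  shows "is_forest (edge_subgraph dual D) \<longleftrightarrow> graph_connected (edge_subgraph (graph_of V E) (E - D))"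
proof -
  let ?G = "graph_of V E"
  have "finite D" using assms(2) finite_E by (rule finite_subset)
  then show ?thesis using assms(2)
  proof (induction D)
    case empty
    have "is_forest (edge_subgraph dual {})"
      by (auto simp: is_forest_def is_cycle_def edge_subgraph_def)
    then show ?case using con by (simp add: edge_subgraph_def graph_of_def)
  next
    case (insert e D)
    then have e: "e \<in> E" "e \<notin> D" "D \<subseteq> E" by auto
    obtain a b where ab: "e = {a, b}" "a \<in> V" "b \<in> V" using e(1) by (elim edge_ends)
    obtain F1 F2 where F: "F1 \<in> components (- drawing E)" "F2 \<in> components (- drawing E)" "ends dual e = {F1, F2}"
      using e(1) by (rule dual_edge_ends)
    have "F1 \<in> verts dual" using F(1) by (simp add: dual_graph_def faces_eq)
    then have "is_forest (edge_subgraph dual (insert e D)) \<longleftrightarrow>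
        graph_connected (edge_subgraph ?G (E - D)) \<and> (F1, F2) \<notin> reach dual D"
      using is_forest_insert[OF F(3) _ e(2)] insert.IH e(3) by simp
    also have "\<dots> \<longleftrightarrow> graph_connected (edge_subgraph ?G (insert e (E - insert e D))) \<and>
        (a, b) \<in> reach ?G (E - insert e D)"
    proof -
      have "insert e (E - insert e D) = E - D" using e by auto
      then show ?thesis using reach_iff_not_dual_reach[OF ab(1) e F(3)] by simp
    qed
    also have "\<dots> \<longleftrightarrow> graph_connected (edge_subgraph ?G (E - insert e D))"
      using ab by (intro graph_connected_insert[symmetric]) (simp_all add: graph_of_def)
    finally show ?case .
  qed
qed

end

section \<open>Integer points of a cube modulo tensions\<close>

text \<open>Classes may be counted by any complete system of invariants.\<close>

lemma card_image_eq_if_same_kernel: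
  assumes "\<And>x y. x \<in> X \<Longrightarrow> y \<in> X \<Longrightarrow> g x = g y \<longleftrightarrow> h x = h y"
  shows "card (g ` X) = card (h ` X)"
proof -
  define k where "k z = h (SOME x. x \<in> X \<and> g x = z)" for z
  have k: "k (g x) = h x" if "x \<in> X" for x
  proof -
    have "(SOME y. y \<in> X \<and> g y = g x) \<in> X \<and> g (SOME y. y \<in> X \<and> g y = g x) = g x"
      by (rule someI[of _ x]) (use that in simp)
    then show ?thesis unfolding k_def using assms that by blast
  qed
  have "bij_betw k (g ` X) (h ` X)"
    unfolding bij_betw_def
  proof
    show "inj_on k (g ` X)" using k assms by (auto simp: inj_on_def)
    show "k ` g ` X = h ` X" using k by (auto simp: image_image)
  qed
  then show ?thesis by (rule bij_betw_same_card)
qed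

lemma finite_gap_free_int_set:
  fixes D :: "int set"
  assumes "finite D" "D \<noteq> {}" and gap: "\<And>a b. a \<in> D \<Longrightarrow> b \<in> D \<Longrightarrow> a < b \<Longrightarrow> a + 1 \<in> D"
  shows "D = {Min D..Max D}"
proof
  show "D \<subseteq> {Min D..Max D}" using assms(1) by auto
  have "Min D + int k \<in> D" if "Min D + int k \<le> Max D" for k
    using that
  proof (induction k)
    case (Suc k)
    then show ?case using gap[of "Min D + int k" "Max D"] assms(1,2) by (simp add: algebra_simps)
  qed (use assms(1,2) in simp)
  then have "x \<in> D" if "x \<in> {Min D..Max D}" for x
    using that by (metis atLeastAtMost_iff diff_ge_0_iff_ge le_add_diff_inverse zero_le_imp_eq_int)
  then show "{Min D..Max D} \<subseteq> D" by blast
qed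

lemma card_minus_interval:
  fixes D :: "int set"
  assumes "finite D" "D \<noteq> {}" "\<And>a b. a \<in> D \<Longrightarrow> b \<in> D \<Longrightarrow> a < b \<Longrightarrow> a + 1 \<in> D"
  shows "card ((\<lambda>(a, j). a - j) ` (D \<times> {0..int t})) = card D + t"
proof -
  obtain m M where D: "D = {m..M}" and le: "m \<le> M"
  proof
    show "D = {Min D..Max D}" using assms by (rule finite_gap_free_int_set)
    show "Min D \<le> Max D" using assms(1,2) by simp
  qed
  have "(\<lambda>(a, j). a - j) ` ({m..M} \<times> {0..int t}) = {m - int t..M}"
  proof
    show "{m - int t..M} \<subseteq> (\<lambda>(a, j). a - j) ` ({m..M} \<times> {0..int t})"
    proof
      fix x assume "x \<in> {m - int t..M}"
      then have "x = (case (max m x, max m x - x) of (a, j) \<Rightarrow> a - j)"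
        "(max m x, max m x - x) \<in> {m..M} \<times> {0..int t}"
        using le by auto
      then show "x \<in> (\<lambda>(a, j). a - j) ` ({m..M} \<times> {0..int t})" by (rule image_eqI)
    qed
  qed auto
  then show ?thesis using le by (simp add: D)
qed

text \<open>The counting step of the recursion. Each fibre of \<open>f\<close> carries an interval of values of \<open>d\<close>, and
  subtracting \<open>0..t\<close> makes each of the \<open>card (f ` X)\<close> intervals longer by \<open>t\<close>.\<close>

lemma card_sheared_image:
  fixes f :: "'x \<Rightarrow> 'b" and d :: "'x \<Rightarrow> int"
  assumes "finite X"
    and gap: "\<And>x y. x \<in> X \<Longrightarrow> y \<in> X \<Longrightarrow> f x = f y \<Longrightarrow> d x < d y \<Longrightarrow> \<exists>z\<in>X. f z = f x \<and> d z = d x + 1"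
  shows "card ((\<lambda>(x, j). (f x, d x - j)) ` (X \<times> {0..int t})) =
    card ((\<lambda>x. (f x, d x)) ` X) + t * card (f ` X)"
proof -
  define D where "D k = d ` {x \<in> X. f x = k}" for k
  have D: "finite (D k)" "k \<in> f ` X \<Longrightarrow> D k \<noteq> {}" for k
    using assms(1) by (auto simp: D_def)
  have gapD: "a + 1 \<in> D k" if "a \<in> D k" "b \<in> D k" "a < b" for a b k
  proof -
    from that obtain x y where "x \<in> X" "f x = k" "a = d x" "y \<in> X" "f y = k" "b = d y"
      unfolding D_def by blast
    with gap[of x y] that(3) obtain z where "z \<in> X" "f z = k" "d z = a + 1" by auto
    then show ?thesis unfolding D_def by force
  qed
  have Sigma_image: "(\<lambda>(x, j). (f x, h (d x) j)) ` (X \<times> J) =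
      (SIGMA k:f ` X. (\<lambda>(a, j). h a j) ` (D k \<times> J))" for h :: "int \<Rightarrow> int \<Rightarrow> int" and J
  proof (intro Set.set_eqI iffI)
    fix z assume "z \<in> (SIGMA k:f ` X. (\<lambda>(a, j). h a j) ` (D k \<times> J))"
    then obtain x j where "x \<in> X" "j \<in> J" "z = (f x, h (d x) j)"
      by (auto simp: D_def)
    then show "z \<in> (\<lambda>(x, j). (f x, h (d x) j)) ` (X \<times> J)"
      by (intro image_eqI[of _ _ "(x, j)"]) auto
  next
    fix z assume "z \<in> (\<lambda>(x, j). (f x, h (d x) j)) ` (X \<times> J)"
    then obtain x j where z: "x \<in> X" "j \<in> J" "z = (f x, h (d x) j)" by auto
    then have "d x \<in> D (f x)" by (simp add: D_def)
    with z have "h (d x) j \<in> (\<lambda>(a, j). h a j) ` (D (f x) \<times> J)"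
      by (intro image_eqI[of _ _ "(d x, j)"]) auto
    with z show "z \<in> (SIGMA k:f ` X. (\<lambda>(a, j). h a j) ` (D k \<times> J))" by simp
  qed
  have "(\<lambda>(x, j). (f x, d x - j)) ` (X \<times> {0..int t}) =
      (SIGMA k:f ` X. (\<lambda>(a, j). a - j) ` (D k \<times> {0..int t}))"
    by (rule Sigma_image)
  then have "card ((\<lambda>(x, j). (f x, d x - j)) ` (X \<times> {0..int t})) =
      (\<Sum>k\<in>f ` X. card ((\<lambda>(a, j). a - j) ` (D k \<times> {0..int t})))"
    using assms(1) D(1) by simp
  also have "\<dots> = (\<Sum>k\<in>f ` X. card (D k) + t)"
    using D gapD by (intro sum.cong HOL.refl card_minus_interval)
  also have "\<dots> = (\<Sum>k\<in>f ` X. card (D k)) + t * card (f ` X)"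
    by (simp add: sum.distrib)
  also have "(\<Sum>k\<in>f ` X. card (D k)) = card (SIGMA k:f ` X. D k)"
    using assms(1) D(1) by simp
  also have "(SIGMA k:f ` X. D k) = (\<lambda>x. (f x, d x)) ` X"
  proof (intro equalityI subsetI)
    fix z assume "z \<in> (SIGMA k:f ` X. D k)"
    then obtain y where "y \<in> X" "z = (f y, d y)" by (auto simp: D_def)
    then show "z \<in> (\<lambda>x. (f x, d x)) ` X" by blast
  qed (auto simp: D_def)
  finally show ?thesis .
qed

definition int_box :: "nat \<Rightarrow> 'e set \<Rightarrow> ('e \<Rightarrow> int) set" where
  "int_box t R = {x. (\<forall>e\<in>R. 0 \<le> x e \<and> x e \<le> int t) \<and> (\<forall>e. e \<notin> R \<longrightarrow> x e = 0)}"

lemma finite_int_box: assumes "finite R" shows "finite (int_box t R)"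
proof -
  have "int_box t R \<subseteq> {x. \<forall>e. (e \<in> R \<longrightarrow> x e \<in> {0..int t}) \<and> (e \<notin> R \<longrightarrow> x e = 0)}"
    by (auto simp: int_box_def)
  then show ?thesis
    using finite_set_of_finite_funs[OF assms, of "{0..int t}" 0] finite_subset by blast
qed

lemma int_box_insert:
  assumes "e \<notin> R"
  shows "int_box t (insert e R) = (\<lambda>(x, j). x(e := j)) ` (int_box t R \<times> {0..int t})"
proof
  show "int_box t (insert e R) \<subseteq> (\<lambda>(x, j). x(e := j)) ` (int_box t R \<times> {0..int t})"
  proof
    fix x assume x: "x \<in> int_box t (insert e R)"
    then have "x = (case (x(e := 0), x e) of (x, j) \<Rightarrow> x(e := j))"
      "(x(e := 0), x e) \<in> int_box t R \<times> {0..int t}"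
      by (auto simp: int_box_def)
    then show "x \<in> (\<lambda>(x, j). x(e := j)) ` (int_box t R \<times> {0..int t})" by (rule image_eqI)
  qed
qed (use assms in \<open>auto simp: int_box_def\<close>)

locale digraph =
  fixes E :: "'e set" and src tgt :: "'e \<Rightarrow> 'v"
  assumes finite_E: "finite E"
begin

text \<open>Ignoring the coordinates in \<open>C\<close> amounts to factoring out the unit vectors of \<open>C\<close> as well. So
  \<open>C\<close> is the set of contracted elements of the dual matroid.\<close>

definition cong_tension :: "'e set \<Rightarrow> ('e \<Rightarrow> int) \<Rightarrow> ('e \<Rightarrow> int) \<Rightarrow> bool" where
  "cong_tension C x y \<longleftrightarrow> (\<exists>\<phi>::'v \<Rightarrow> int. \<forall>f\<in>E - C. x f - y f = \<phi> (src f) - \<phi> (tgt f))"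

definition tension_class :: "'e set \<Rightarrow> ('e \<Rightarrow> int) \<Rightarrow> ('e \<Rightarrow> int) set" where
  "tension_class C x = {y. cong_tension C x y}"

text \<open>No nonzero tension is supported on \<open>C\<close>: the columns of the dual matrix indexed by \<open>C\<close> are
  linearly independent.\<close>

definition tension_free :: "'e set \<Rightarrow> bool" where
  "tension_free C \<longleftrightarrow> (\<forall>\<phi>::'v \<Rightarrow> int.
     (\<forall>f\<in>E - C. \<phi> (src f) = \<phi> (tgt f)) \<longrightarrow> (\<forall>f\<in>E. \<phi> (src f) = \<phi> (tgt f)))"

lemma cong_tension_refl: "cong_tension C x x"
  unfolding cong_tension_def by (intro exI[of _ "\<lambda>_. 0"]) simp

lemma cong_tension_sym: assumes "cong_tension C x y" shows "cong_tension C y x"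
proof -
  from assms obtain \<phi> :: "'v \<Rightarrow> int" where "\<forall>f\<in>E - C. x f - y f = \<phi> (src f) - \<phi> (tgt f)"
    unfolding cong_tension_def by blast
  then show ?thesis unfolding cong_tension_def by (intro exI[of _ "\<lambda>v. - \<phi> v"]) force
qed

lemma cong_tension_trans:
  assumes "cong_tension C x y" "cong_tension C y z" shows "cong_tension C x z"
proof -
  from assms obtain \<phi> \<psi> :: "'v \<Rightarrow> int" where
    "\<forall>f\<in>E - C. x f - y f = \<phi> (src f) - \<phi> (tgt f)" "\<forall>f\<in>E - C. y f - z f = \<psi> (src f) - \<psi> (tgt f)"
    unfolding cong_tension_def by blast
  then show ?thesis unfolding cong_tension_def by (intro exI[of _ "\<lambda>v. \<phi> v + \<psi> v"]) force
qed

lemma tension_class_eq_iff: "tension_class C x = tension_class C y \<longleftrightarrow> cong_tension C x y"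
  unfolding tension_class_def
  by (metis (mono_tags, lifting) Collect_cong cong_tension_refl cong_tension_sym cong_tension_trans mem_Collect_eq)

lemma tension_free_mono: "tension_free D \<Longrightarrow> C \<subseteq> D \<Longrightarrow> tension_free C"
  unfolding tension_free_def by blast

text \<open>The indicator function of an upper level set of \<open>\<phi>\<close> has a tension with values in \<open>{-1, 0, 1}\<close> that
  conforms to that of \<open>\<phi>\<close>, so subtracting it never overshoots zero. This replaces the total
  unimodularity of the incidence matrix.\<close>

lemma unit_tension:
  fixes \<phi> :: "'v \<Rightarrow> int"
  assumes "\<phi> (src e) > \<phi> (tgt e)"
  obtains \<psi> :: "'v \<Rightarrow> int" where "\<psi> (src e) - \<psi> (tgt e) = 1"
    "\<And>f. min 0 (\<phi> (src f) - \<phi> (tgt f)) \<le> \<psi> (src f) - \<psi> (tgt f)"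
    "\<And>f. \<psi> (src f) - \<psi> (tgt f) \<le> max 0 (\<phi> (src f) - \<phi> (tgt f))"
  by (rule that[of "\<lambda>v. if \<phi> v \<ge> \<phi> (src e) then 1 else 0"]) (use assms in auto)

text \<open>There is a tension that is \<open>1\<close> at \<open>e\<close> and vanishes elsewhere off \<open>C\<close>; its multiples clear the
  coordinate at \<open>e\<close>.\<close>

lemma class_count_insert_dependent:
  assumes e: "e \<in> E" "e \<notin> R" "e \<notin> C" and free: "tension_free C" "\<not> tension_free (insert e C)"
  shows "tension_class C ` int_box t (insert e R) = tension_class C ` int_box t R"
proof -
  from free(2) obtain \<phi> :: "'v \<Rightarrow> int" where
    \<phi>: "\<forall>f\<in>E - insert e C. \<phi> (src f) = \<phi> (tgt f)" "\<not> (\<forall>f\<in>E. \<phi> (src f) = \<phi> (tgt f))"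
    unfolding tension_free_def by blast
  have "\<phi> (src e) \<noteq> \<phi> (tgt e)"
    using \<phi> free(1) unfolding tension_free_def by (metis Diff_iff insert_iff)
  then obtain \<phi>' :: "'v \<Rightarrow> int" where
    \<phi>': "\<forall>f\<in>E - insert e C. \<phi>' (src f) = \<phi>' (tgt f)" "\<phi>' (src e) > \<phi>' (tgt e)"
  proof (cases "\<phi> (src e) > \<phi> (tgt e)")
    case False
    with \<open>\<phi> (src e) \<noteq> \<phi> (tgt e)\<close> \<phi>(1) show thesis by (intro that[of "\<lambda>v. - \<phi> v"]) auto
  qed (use \<phi>(1) that in blast)
  obtain \<psi> :: "'v \<Rightarrow> int" where \<psi>: "\<psi> (src e) - \<psi> (tgt e) = 1"
    "\<And>f. min 0 (\<phi>' (src f) - \<phi>' (tgt f)) \<le> \<psi> (src f) - \<psi> (tgt f)"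
    "\<And>f. \<psi> (src f) - \<psi> (tgt f) \<le> max 0 (\<phi>' (src f) - \<phi>' (tgt f))"
    using unit_tension[OF \<phi>'(2)] by blast
  have \<psi>0: "\<psi> (src f) = \<psi> (tgt f)" if "f \<in> E - insert e C" for f
    using \<phi>'(1) that \<psi>(2,3)[of f] by simp
  have cl: "tension_class C (x(e := j)) = tension_class C x" if "x e = 0" for x j
    unfolding tension_class_eq_iff cong_tension_def
  proof (intro exI ballI)
    fix f assume f: "f \<in> E - C"
    show "(x(e := j)) f - x f = j * \<psi> (src f) - j * \<psi> (tgt f)"
    proof (cases "f = e")
      case True
      then show ?thesis using that \<psi>(1) by (simp flip: right_diff_distrib)
    qed (use f \<psi>0[of f] in auto)
  qed
  have "tension_class C ` int_box t (insert e R) =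
      (\<lambda>(x, j). tension_class C (x(e := j))) ` (int_box t R \<times> {0..int t})"
    unfolding int_box_insert[OF e(2)] image_image by (simp add: case_prod_unfold)
  also have "\<dots> = (\<lambda>(x, j). tension_class C x) ` (int_box t R \<times> {0..int t})"
    by (intro image_cong HOL.refl) (use e(2) in \<open>auto simp: int_box_def intro!: cl\<close>)
  also have "\<dots> = tension_class C ` int_box t R" by force
  finally show ?thesis .
qed

text \<open>Fix a representative \<open>r x\<close> for each class modulo tensions off \<open>insert e C\<close>. The value at \<open>e\<close> of the
  tension leading from it to \<open>x\<close> is determined since \<open>insert e C\<close> supports no tension. Corrected
  by the coordinate of \<open>x\<close> at \<open>e\<close>, it yields an integer \<open>d x\<close> that, with the coarse class, determines
  the class off \<open>C\<close>. Raising the coordinate at \<open>e\<close> lowers \<open>d\<close>, and \<open>unit_tension\<close>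
  shows that \<open>d\<close> takes an interval of values on each coarse class.\<close>

lemma class_count_insert_independent:
  assumes e: "e \<in> E" "e \<notin> R" "e \<notin> C" and R: "R \<subseteq> E" "R \<inter> C = {}"
    and free: "tension_free (insert e C)"
  shows "card (tension_class C ` int_box t (insert e R)) =
    card (tension_class C ` int_box t R) + t * card (tension_class (insert e C) ` int_box t R)"
proof -
  let ?C = "insert e C"
  let ?f = "tension_class ?C"
  have uniq: "\<phi> (src e) - \<phi> (tgt e) = \<psi> (src e) - \<psi> (tgt e)"
    if "\<forall>f\<in>E - ?C. \<phi> (src f) - \<phi> (tgt f) = \<psi> (src f) - \<psi> (tgt f)" for \<phi> \<psi> :: "'v \<Rightarrow> int"
  proof -
    have "\<forall>f\<in>E - ?C. \<phi> (src f) - \<psi> (src f) = \<phi> (tgt f) - \<psi> (tgt f)"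
      using that by force
    then have "\<phi> (src e) - \<psi> (src e) = \<phi> (tgt e) - \<psi> (tgt e)"
      using free e(1) unfolding tension_free_def by (elim allE[of _ "\<lambda>v. \<phi> v - \<psi> v"]) simp
    then show ?thesis by simp
  qed
  \<comment> \<open>The base point \<open>r x\<close> depends on the coarse class only.\<close>
  define r where "r x = (SOME y. y \<in> ?f x)" for x
  define p where "p x = (SOME \<phi>::'v \<Rightarrow> int. \<forall>f\<in>E - ?C. x f - r x f = \<phi> (src f) - \<phi> (tgt f))" for x
  define d where "d x = p x (src e) - p x (tgt e) - (x e - r x e)" for x
  have "r x \<in> ?f x" for x
    unfolding r_def by (rule someI[of _ x]) (simp add: tension_class_def cong_tension_refl)
  then have "\<exists>\<phi>::'v \<Rightarrow> int. \<forall>f\<in>E - ?C. x f - r x f = \<phi> (src f) - \<phi> (tgt f)" for x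
    by (simp add: tension_class_def cong_tension_def)
  then have p: "\<forall>f\<in>E - ?C. x f - r x f = p x (src f) - p x (tgt f)" for x
    unfolding p_def by (rule someI_ex)
  have d: "d x - d y = \<phi> (src e) - \<phi> (tgt e) - (x e - y e)"
    if \<phi>: "\<forall>f\<in>E - ?C. x f - y f = \<phi> (src f) - \<phi> (tgt f)" for x y and \<phi> :: "'v \<Rightarrow> int"
  proof -
    have "?f x = ?f y" unfolding tension_class_eq_iff cong_tension_def using \<phi> by blast
    then have "r x = r y" by (simp add: r_def)
    have "p x (src e) - p x (tgt e) = (\<phi> (src e) + p y (src e)) - (\<phi> (tgt e) + p y (tgt e))"
      by (rule uniq[of "p x" "\<lambda>v. \<phi> v + p y v"]) (use p[of x] p[of y] \<phi> \<open>r x = r y\<close> in force)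
    then show ?thesis by (simp add: d_def \<open>r x = r y\<close>)
  qed
  have split: "tension_class C x = tension_class C y \<longleftrightarrow> (?f x, d x) = (?f y, d y)" for x y
  proof
    assume "tension_class C x = tension_class C y"
    then obtain \<phi> :: "'v \<Rightarrow> int" where \<phi>: "\<forall>f\<in>E - C. x f - y f = \<phi> (src f) - \<phi> (tgt f)"
      by (auto simp: tension_class_eq_iff cong_tension_def)
    then have "?f x = ?f y" unfolding tension_class_eq_iff cong_tension_def by blast
    moreover have "d x = d y" using d[of x y \<phi>] \<phi> e by auto
    ultimately show "(?f x, d x) = (?f y, d y)" by simp
  next
    assume eq: "(?f x, d x) = (?f y, d y)"
    then have "cong_tension ?C x y" by (simp add: tension_class_eq_iff)
    then obtain \<phi> :: "'v \<Rightarrow> int" where \<phi>: "\<forall>f\<in>E - ?C. x f - y f = \<phi> (src f) - \<phi> (tgt f)"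
      by (auto simp: cong_tension_def)
    have "x e - y e = \<phi> (src e) - \<phi> (tgt e)" using d[OF \<phi>] eq by simp
    with \<phi> have "\<forall>f\<in>E - C. x f - y f = \<phi> (src f) - \<phi> (tgt f)" by auto
    then show "tension_class C x = tension_class C y"
      unfolding tension_class_eq_iff cong_tension_def by blast
  qed
  have upd: "?f (x(e := j)) = ?f x" "d (x(e := j)) = d x - j" if "x e = 0" for x j
  proof -
    show "?f (x(e := j)) = ?f x"
      unfolding tension_class_eq_iff cong_tension_def by (rule exI[of _ "\<lambda>_. 0"]) simp
    show "d (x(e := j)) = d x - j"
      using d[of "x(e := j)" x "\<lambda>_. 0"] that by simp
  qed
  have e0: "x e = 0" if "x \<in> int_box t R" for x using that e(2) by (simp add: int_box_def)
  have gap: "\<exists>z\<in>int_box t R. ?f z = ?f x \<and> d z = d x + 1"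
    if x: "x \<in> int_box t R" and y: "y \<in> int_box t R" and xy: "?f x = ?f y" "d x < d y" for x y
  proof -
    have "cong_tension ?C y x" using xy(1) by (simp flip: tension_class_eq_iff)
    then obtain \<phi> :: "'v \<Rightarrow> int" where \<phi>: "\<forall>f\<in>E - ?C. y f - x f = \<phi> (src f) - \<phi> (tgt f)"
      by (auto simp: cong_tension_def)
    have "\<phi> (src e) > \<phi> (tgt e)" using d[OF \<phi>] xy(2) e0[OF x] e0[OF y] by simp
    then obtain \<psi> :: "'v \<Rightarrow> int" where \<psi>: "\<psi> (src e) - \<psi> (tgt e) = 1"
      "\<And>f. min 0 (\<phi> (src f) - \<phi> (tgt f)) \<le> \<psi> (src f) - \<psi> (tgt f)"
      "\<And>f. \<psi> (src f) - \<psi> (tgt f) \<le> max 0 (\<phi> (src f) - \<phi> (tgt f))"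
      using unit_tension by blast
    \<comment> \<open>Conformity of \<open>\<psi>\<close> keeps \<open>z\<close> between \<open>x\<close> and \<open>y\<close>, hence in the cube.\<close>
    define z where "z f = (if f \<in> R then x f + (\<psi> (src f) - \<psi> (tgt f)) else 0)" for f
    have "z \<in> int_box t R"
      unfolding int_box_def
    proof (intro CollectI conjI ballI allI impI)
      fix f assume f: "f \<in> R"
      then have "y f - x f = \<phi> (src f) - \<phi> (tgt f)" using \<phi> R e(2) by auto
      moreover have "0 \<le> x f" "x f \<le> int t" "0 \<le> y f" "y f \<le> int t"
        using x y f by (auto simp: int_box_def)
      ultimately show "0 \<le> z f" "z f \<le> int t"
        using \<psi>(2,3)[of f] f by (simp_all add: z_def)
    qed (simp add: z_def)
    moreover have zx: "\<forall>f\<in>E - ?C. z f - x f = \<psi> (src f) - \<psi> (tgt f)"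
    proof
      fix f assume f: "f \<in> E - ?C"
      show "z f - x f = \<psi> (src f) - \<psi> (tgt f)"
      proof (cases "f \<in> R")
        case False
        then have "x f = 0" "y f = 0" using x y by (auto simp: int_box_def)
        then have "\<phi> (src f) - \<phi> (tgt f) = 0" using bspec[OF \<phi> f] by simp
        then show ?thesis using \<psi>(2,3)[of f] False \<open>x f = 0\<close> by (simp add: z_def)
      qed (simp add: z_def)
    qed
    moreover have "z e = 0" using e(2) by (simp add: z_def)
    then have "d z = d x + 1" using d[OF zx] \<psi>(1) e0[OF x] by simp
    moreover have "?f z = ?f x" unfolding tension_class_eq_iff cong_tension_def using zx by blast
    ultimately show ?thesis by blast
  qed
  have "card (tension_class C ` int_box t (insert e R)) = card ((\<lambda>x. (?f x, d x)) ` int_box t (insert e R))"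
    by (rule card_image_eq_if_same_kernel) (rule split)
  also have "(\<lambda>x. (?f x, d x)) ` int_box t (insert e R) =
      (\<lambda>(x, j). (?f (x(e := j)), d (x(e := j)))) ` (int_box t R \<times> {0..int t})"
    unfolding int_box_insert[OF e(2)] image_image by (simp add: case_prod_unfold)
  also have "\<dots> = (\<lambda>(x, j). (?f x, d x - j)) ` (int_box t R \<times> {0..int t})"
    by (intro image_cong HOL.refl) (auto simp: upd e0)
  also have "card \<dots> = card ((\<lambda>x. (?f x, d x)) ` int_box t R) + t * card (?f ` int_box t R)"
    using gap by (intro card_sheared_image finite_int_box finite_subset[OF R(1) finite_E])
  also have "card ((\<lambda>x. (?f x, d x)) ` int_box t R) = card (tension_class C ` int_box t R)"
    by (rule card_image_eq_if_same_kernel) (rule split[symmetric])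
  finally show ?thesis .
qed

text \<open>Both cases of the recursion agree with splitting the sets \<open>S\<close> according to whether they contain the
  new edge \<open>e\<close>: those that do correspond to sets counted with \<open>e\<close> contracted, and there are none if
  \<open>insert e C\<close> already supports a tension.\<close>

lemma card_tension_classes:
  assumes "R \<subseteq> E" "R \<inter> C = {}" "tension_free C"
  shows "card (tension_class C ` int_box t R) =
    (\<Sum>S\<in>Pow R. if tension_free (C \<union> S) then t ^ card S else 0)"
proof -
  have "finite R" using assms(1) finite_E by (rule finite_subset)
  then show ?thesis using assms
  proof (induction R arbitrary: C)
    case empty
    have "int_box t ({} :: 'e set) = {\<lambda>_. 0}" by (auto simp: int_box_def)
    then show ?case using empty by simp
  next
    case (insert e R)
    let ?g = "\<lambda>C S. if tension_free (C \<union> S) then t ^ card S else 0"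
    have e: "e \<in> E" "e \<notin> R" "e \<notin> C" and R: "R \<subseteq> E" "R \<inter> C = {}" "R \<inter> insert e C = {}"
      using insert by auto
    have IH: "card (tension_class C ` int_box t R) = sum (?g C) (Pow R)"
      using insert.IH R insert.prems by simp
    have "sum (?g C) (Pow (insert e R)) = sum (?g C) (Pow R) + sum (?g C) (insert e ` Pow R)"
      unfolding Pow_insert using insert.hyps by (intro sum.union_disjoint) auto
    also have "sum (?g C) (insert e ` Pow R) = (\<Sum>S\<in>Pow R. ?g C (insert e S))"
      using e(2) by (subst sum.reindex) (auto simp: inj_on_def)
    also have "\<dots> = (\<Sum>S\<in>Pow R. t * ?g (insert e C) S)"
    proof (rule sum.cong[OF HOL.refl])
      fix S assume "S \<in> Pow R"
      then have "card (insert e S) = Suc (card S)"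
        using e(2) insert.hyps(1) by (subst card_insert_disjoint) (auto intro: finite_subset)
      then show "?g C (insert e S) = t * ?g (insert e C) S" by simp
    qed
    also have "\<dots> = t * sum (?g (insert e C)) (Pow R)" by (simp only: sum_distrib_left)
    finally have sum: "sum (?g C) (Pow (insert e R)) =
        sum (?g C) (Pow R) + t * sum (?g (insert e C)) (Pow R)" .
    show ?case
    proof (cases "tension_free (insert e C)")
      case True
      have "card (tension_class (insert e C) ` int_box t R) = sum (?g (insert e C)) (Pow R)"
        using insert.IH R True by simp
      then show ?thesis
        using class_count_insert_independent[OF e R(1,2) True] IH sum by simp
    next
      case False
      then have "\<not> tension_free (insert e C \<union> S)" for S
        using tension_free_mono[of "insert e C \<union> S" "insert e C"] by blast
      then have "sum (?g (insert e C)) (Pow R) = 0" by simp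
      then show ?thesis
        using class_count_insert_dependent[OF e insert.prems(3) False] IH sum by simp
    qed
  qed
qed

end

section \<open>The kernel of the dual matrix\<close>

lemma index_mult_mat_sum:
  assumes "A \<in> carrier_mat n m" "B \<in> carrier_mat m k" "i < n" "j < k"
  shows "(A * B) $$ (i, j) = (\<Sum>l<m. A $$ (i, l) * B $$ (l, j))"
  using assms by (simp add: scalar_prod_def lessThan_atLeast0)

lemma index_mult_mat_vec_sum:
  assumes "A \<in> carrier_mat n m" "x \<in> carrier_vec m" "i < n"
  shows "(A *\<^sub>v x) $ i = (\<Sum>l<m. A $$ (i, l) * x $ l)"
  using assms by (simp add: scalar_prod_def lessThan_atLeast0)

lemma left_factors_compose:
  fixes S T P Q A B :: "int mat"
  assumes "S \<in> carrier_mat n n" "T \<in> carrier_mat n n" "P \<in> carrier_mat n n" "Q \<in> carrier_mat n n"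
    and "A \<in> carrier_mat n m" "B \<in> carrier_mat n m" "C \<in> carrier_mat n m"
    and "B = P * A" "A = Q * B" "C = S * B" "B = T * C"
  shows "\<exists>P\<in>carrier_mat n n. \<exists>Q\<in>carrier_mat n n. C = P * A \<and> A = Q * C"
proof (intro bexI conjI)
  show "C = (S * P) * A"
    unfolding assms(10) assms(8) by (rule assoc_mult_mat[OF assms(1,3,5), symmetric])
  have "A = Q * (T * C)" unfolding assms(11)[symmetric] by (rule assms(9))
  then show "A = (Q * T) * C" unfolding assoc_mult_mat[OF assms(4,2,7)] .
qed (rule mult_carrier_mat[OF assms(4,2)] mult_carrier_mat[OF assms(1,3)])+

text \<open>Row operations are left multiplications by integral elementary matrices with integral inverses.
  Recording both factors makes the row spaces agree over every ring.\<close>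

lemma unimodular_row_ops_factors:
  assumes "unimodular_row_ops A M" "A \<in> carrier_mat n m"
  shows "M \<in> carrier_mat n m \<and>
    (\<exists>P\<in>carrier_mat n n. \<exists>Q\<in>carrier_mat n n. M = P * A \<and> A = Q * M)"
  using assms(1)
proof induction
  case refl
  show ?case
    by (intro conjI assms(2) bexI[of _ "1\<^sub>m n"] one_carrier_mat
        left_mult_one_mat[OF assms(2), symmetric])
next
  case (swap B k l)
  then obtain P Q where B: "B \<in> carrier_mat n m" and PQ: "P \<in> carrier_mat n n" "Q \<in> carrier_mat n n"
    "B = P * A" "A = Q * B" by blast
  have kl: "k < n" "l < n" using swap.hyps B by auto
  let ?C = "swaprows k l B"
  have C: "?C \<in> carrier_mat n m" using B by auto
  have "B = swaprows k l ?C" using B kl by (intro eq_matI) auto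
  also have "\<dots> = swaprows_mat n k l * ?C" by (rule swaprows_mat[OF C kl])
  finally show ?case
    by (intro conjI C left_factors_compose[OF swaprows_mat_carrier swaprows_mat_carrier
        PQ(1,2) assms(2) B C PQ(3,4) swaprows_mat[OF B kl]])
next
  case (negate B k)
  then obtain P Q where B: "B \<in> carrier_mat n m" and PQ: "P \<in> carrier_mat n n" "Q \<in> carrier_mat n n"
    "B = P * A" "A = Q * B" by blast
  let ?C = "multrow k (-1) B"
  have C: "?C \<in> carrier_mat n m" using B by auto
  have "B = multrow k (-1) ?C" using B by (intro eq_matI) auto
  also have "\<dots> = multrow_mat n k (-1) * ?C" by (rule multrow_mat[OF C])
  finally show ?case
    by (intro conjI C left_factors_compose[OF multrow_mat_carrier multrow_mat_carrier
        PQ(1,2) assms(2) B C PQ(3,4) multrow_mat[OF B]])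
next
  case (add B k l c)
  then obtain P Q where B: "B \<in> carrier_mat n m" and PQ: "P \<in> carrier_mat n n" "Q \<in> carrier_mat n n"
    "B = P * A" "A = Q * B" by blast
  have kl: "l < n" "k \<noteq> l" "k < n" using add.hyps B by auto
  let ?C = "addrow c k l B"
  have C: "?C \<in> carrier_mat n m" using B by auto
  have "B = addrow (-c) k l ?C" using B kl by (intro eq_matI) auto
  also have "\<dots> = addrow_mat n (-c) k l * ?C" by (rule addrow_mat[OF C kl(1)])
  finally show ?case
    by (intro conjI C left_factors_compose[OF addrow_mat_carrier addrow_mat_carrier
        PQ(1,2) assms(2) B C PQ(3,4) addrow_mat[OF B kl(1)]])
qed

lemma sum_skip:
  fixes f :: "nat \<Rightarrow> 'b :: comm_monoid_add"
  assumes "r < n" "f r = 0"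
  shows "(\<Sum>k<n. f k) = (\<Sum>k<n - 1. f (if k < r then k else Suc k))"
proof -
  let ?s = "\<lambda>k. if k < r then k else Suc k"
  have "bij_betw ?s {..<n - 1} ({..<n} - {r})"
  proof (rule bij_betw_byWitness[where f' = "\<lambda>k. if k < r then k else k - 1"])
  qed (use assms(1) in auto)
  then have "(\<Sum>k<n - 1. f (?s k)) = sum f ({..<n} - {r})" by (rule sum.reindex_bij_betw)
  also have "\<dots> = (\<Sum>k<n. f k)"
    using assms by (simp add: sum.remove[of "{..<n}" r])
  finally show ?thesis by simp
qed

lemma sum_split_at:
  fixes f :: "nat \<Rightarrow> 'b :: comm_monoid_add"
  shows "(\<Sum>k<d + w. f k) = (\<Sum>k<d. f k) + (\<Sum>j<w. f (d + j))"
  by (induction w) (simp_all add: add.assoc)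

lemma beside_index:
  assumes "A \<in> carrier_mat n a" "B \<in> carrier_mat n b"
  shows "beside A B \<in> carrier_mat n (a + b)"
    and "i < n \<Longrightarrow> j < a + b \<Longrightarrow> beside A B $$ (i, j) = (if j < a then A $$ (i, j) else B $$ (i, j - a))"
  using assms by (auto simp: beside_def carrier_matD)

text \<open>The zero row contributes nothing, so \<open>[W | I]\<close> and the incidence matrix still are left
  multiples of each other after it has been discarded.\<close>

lemma network_matrix_factors:
  assumes "network_matrix A W" "A \<in> carrier_mat n m"
  obtains P Q where "dim_row W + 1 = n" "dim_col W + dim_row W = m"
    "P \<in> carrier_mat (dim_row W) n" "Q \<in> carrier_mat n (dim_row W)"
    "beside W (1\<^sub>m (dim_row W)) = P * A" "A = Q * beside W (1\<^sub>m (dim_row W))"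
proof -
  let ?w = "dim_row W" and ?N = "beside W (1\<^sub>m (dim_row W))"
  obtain M r where M: "unimodular_row_ops A M" "r < dim_row M" "row M r = 0\<^sub>v (dim_col M)"
    "delete_row r M = ?N"
    using assms(1) by (auto simp: network_matrix_def)
  obtain P Q where Mc: "M \<in> carrier_mat n m" and PQ: "P \<in> carrier_mat n n" "Q \<in> carrier_mat n n"
    "M = P * A" "A = Q * M"
    using unimodular_row_ops_factors[OF M(1) assms(2)] by blast
  have r: "r < n" using M(2) Mc by auto
  have Nc: "?N \<in> carrier_mat ?w (dim_col W + ?w)" by (rule beside_index) auto
  have "?N \<in> carrier_mat (n - 1) m" using Mc by (simp add: M(4)[symmetric] delete_row_def)
  with Nc have dims: "?w = n - 1" "dim_col W + ?w = m" by auto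
  let ?s = "\<lambda>k. if k < r then k else Suc k"
  have N: "?N $$ (i, j) = M $$ (?s i, j)" if "i < ?w" "j < m" for i j
    unfolding M(4)[symmetric] delete_row_def using that Mc dims by simp
  have zero: "M $$ (r, j) = 0" if "j < m" for j
    using arg_cong[OF M(3), of "\<lambda>v. v $ j"] that Mc r by simp
  let ?P = "mat ?w n (\<lambda>(i, j). P $$ (?s i, j))" and ?Q = "mat n ?w (\<lambda>(i, j). Q $$ (i, ?s j))"
  have "?N = ?P * A"
  proof (rule eq_matI)
    fix i j assume "i < dim_row (?P * A)" "j < dim_col (?P * A)"
    then have ij: "i < ?w" "j < m" using assms(2) by auto
    then have "?s i < n" using dims(1) by auto
    then have "?N $$ (i, j) = (\<Sum>l<n. P $$ (?s i, l) * A $$ (l, j))"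
      using N[OF ij] index_mult_mat_sum[OF PQ(1) assms(2)] ij(2) PQ(3) by simp
    also have "\<dots> = (?P * A) $$ (i, j)"
      using index_mult_mat_sum[of ?P ?w n A m i j] assms(2) ij by simp
    finally show "?N $$ (i, j) = (?P * A) $$ (i, j)" .
  qed (use Nc dims assms(2) in auto)
  moreover have "A = ?Q * ?N"
  proof (rule eq_matI)
    fix i j assume "i < dim_row (?Q * ?N)" "j < dim_col (?Q * ?N)"
    then have ij: "i < n" "j < m" using Nc dims by auto
    have "A $$ (i, j) = (\<Sum>l<n. Q $$ (i, l) * M $$ (l, j))"
      using index_mult_mat_sum[OF PQ(2) Mc ij] PQ(4) by simp
    also have "\<dots> = (\<Sum>l<?w. Q $$ (i, ?s l) * M $$ (?s l, j))"
      unfolding dims(1) by (rule sum_skip) (use r zero[OF ij(2)] in auto)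
    also have "\<dots> = (\<Sum>l<?w. ?Q $$ (i, l) * ?N $$ (l, j))"
      by (rule sum.cong) (use ij N in auto)
    also have "\<dots> = (?Q * ?N) $$ (i, j)"
      using index_mult_mat_sum[of ?Q n ?w ?N m i j] Nc dims ij by simp
    finally show "A $$ (i, j) = (?Q * ?N) $$ (i, j)" .
  qed (use Nc dims assms(2) in auto)
  ultimately show thesis using that[of ?P ?Q] dims r by auto
qed

lemma dual_matrix_index:
  shows "dual_matrix W \<in> carrier_mat (dim_col W) (dim_col W + dim_row W)"
    and "i < dim_col W \<Longrightarrow> k < dim_col W + dim_row W \<Longrightarrow>
      dual_matrix W $$ (i, k) = (if k < dim_col W then if i = k then 1 else 0 else - W $$ (k - dim_col W, i))"
proof -
  let ?d = "dim_col W" and ?w = "dim_row W"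
  have c: "1\<^sub>m ?d \<in> carrier_mat ?d ?d" "- transpose_mat W \<in> carrier_mat ?d ?w" by auto
  show "dual_matrix W \<in> carrier_mat ?d (?d + ?w)"
    unfolding dual_matrix_def by (rule beside_index(1)[OF c])
  assume ik: "i < ?d" "k < ?d + ?w"
  show "dual_matrix W $$ (i, k) = (if k < ?d then if i = k then 1 else 0 else - W $$ (k - ?d, i))"
    unfolding dual_matrix_def beside_index(2)[OF c ik] using ik by auto
qed

lemma dual_matrix_mult_vec:
  fixes x :: "real Matrix.vec"
  assumes "x \<in> carrier_vec (dim_col W + dim_row W)" "i < dim_col W"
  shows "(map_mat real_of_int (dual_matrix W) *\<^sub>v x) $ i =
    x $ i - (\<Sum>j<dim_row W. of_int (W $$ (j, i)) * x $ (dim_col W + j))"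
proof -
  let ?d = "dim_col W" and ?w = "dim_row W" and ?D = "map_mat real_of_int (dual_matrix W)"
  have D: "?D \<in> carrier_mat ?d (?d + ?w)" using dual_matrix_index(1)[of W] by simp
  have ent: "?D $$ (i, k) = of_int (if k < ?d then if i = k then 1 else 0 else - W $$ (k - ?d, i))"
    if "k < ?d + ?w" for k
    using dual_matrix_index(1)[of W] dual_matrix_index(2)[OF assms(2) that] that assms(2) by auto
  have "(?D *\<^sub>v x) $ i = (\<Sum>k<?d + ?w. ?D $$ (i, k) * x $ k)"
    by (rule index_mult_mat_vec_sum[OF D assms])
  also have "\<dots> = (\<Sum>k<?d. (if i = k then 1 else 0) * x $ k) + (\<Sum>j<?w. - of_int (W $$ (j, i)) * x $ (?d + j))"
    unfolding sum_split_at by (intro arg_cong2[of _ _ _ _ "(+)"] sum.cong HOL.refl) (simp_all add: ent)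
  also have "(\<Sum>k<?d. (if i = k then 1 else 0) * x $ k) = (\<Sum>k<?d. if i = k then x $ k else 0)"
    by (rule sum.cong) auto
  also have "\<dots> = x $ i" using assms(2) by simp
  finally show ?thesis by (simp add: sum_negf)
qed

text \<open>Transposed incidence matrices take potentials to tensions.\<close>

lemma sum_incidence_column:
  fixes \<phi> :: "'a \<Rightarrow> real"
  assumes "distinct vs" "src (es ! k) \<in> set vs" "tgt (es ! k) \<in> set vs" "src (es ! k) \<noteq> tgt (es ! k)"
    and k: "k < length es"
  shows "(\<Sum>v<length vs. of_int (incidence_matrix vs es src tgt $$ (v, k)) * \<phi> (vs ! v)) =
    \<phi> (src (es ! k)) - \<phi> (tgt (es ! k))"
proof -
  let ?s = "src (es ! k)" and ?t = "tgt (es ! k)"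
  have "(\<Sum>v<length vs. of_int (incidence_matrix vs es src tgt $$ (v, k)) * \<phi> (vs ! v)) =
      (\<Sum>v<length vs. (\<lambda>u. (if u = ?s then \<phi> u else 0) - (if u = ?t then \<phi> u else 0)) (vs ! v))"
    using k assms(4) by (intro sum.cong) (auto simp: incidence_matrix_def)
  also have "\<dots> = (\<Sum>u\<in>set vs. (if u = ?s then \<phi> u else 0) - (if u = ?t then \<phi> u else 0))"
    by (rule sum.reindex_bij_betw) (rule bij_betw_nth[OF assms(1)], auto)
  also have "\<dots> = \<phi> ?s - \<phi> ?t"
    using assms(2,3) by (simp add: sum_subtractf)
  finally show ?thesis .
qed

text \<open>A vector \<open>z\<close> is in the kernel of \<open>[I | -W\<^sup>T]\<close> iff its first block is \<open>W\<^sup>T\<close> applied to its second,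
  that is, iff \<open>z\<close> is the combination of the rows of \<open>[W | I]\<close> with coefficients in the second block.
  The row space of \<open>[W | I]\<close> is that of the incidence matrix, which consists of the tensions.\<close>

lemma dual_matrix_kernel:
  fixes x y :: "real Matrix.vec" and vs :: "'a list" and es :: "'a set list" and src tgt :: "'a set \<Rightarrow> 'a"
  assumes net: "network_matrix (incidence_matrix vs es src tgt) W"
    and vs: "distinct vs"
    and es: "\<forall>e\<in>set es. src e \<in> set vs \<and> tgt e \<in> set vs \<and> src e \<noteq> tgt e"
    and xy: "x \<in> carrier_vec (length es)" "y \<in> carrier_vec (length es)"
  shows "map_mat real_of_int (dual_matrix W) *\<^sub>v x = map_mat real_of_int (dual_matrix W) *\<^sub>v y \<longleftrightarrow>
    (\<exists>\<phi>::'a \<Rightarrow> real. \<forall>k<length es. x $ k - y $ k = \<phi> (src (es ! k)) - \<phi> (tgt (es ! k)))"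
proof -
  let ?n = "length vs" and ?m = "length es" and ?d = "dim_col W" and ?w = "dim_row W"
  let ?A = "incidence_matrix vs es src tgt" and ?N = "beside W (1\<^sub>m (dim_row W))"
  let ?D = "map_mat real_of_int (dual_matrix W)"
  have A: "?A \<in> carrier_mat ?n ?m" by (simp add: incidence_matrix_def)
  obtain P Q where dims: "?w + 1 = ?n" "?d + ?w = ?m"
    and PQ: "P \<in> carrier_mat ?w ?n" "Q \<in> carrier_mat ?n ?w" "?N = P * ?A" "?A = Q * ?N"
    by (rule network_matrix_factors[OF net A])
  have N: "?N \<in> carrier_mat ?w ?m" using beside_index(1)[of W ?w ?d "1\<^sub>m ?w" ?w] dims by auto
  have Nent: "?N $$ (j, k) = (if k < ?d then W $$ (j, k) else if j = k - ?d then 1 else 0)"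
    if "j < ?w" "k < ?m" for j k
    using beside_index(2)[of W ?w ?d "1\<^sub>m ?w" ?w j k] that dims by auto
  have colN: "(\<Sum>j<?w. of_int (?N $$ (j, k)) * q j) =
      (if k < ?d then \<Sum>j<?w. of_int (W $$ (j, k)) * q j else q (k - ?d))" if "k < ?m" for k and q :: "nat \<Rightarrow> real"
  proof (cases "k < ?d")
    case False
    have "(\<Sum>j<?w. of_int (?N $$ (j, k)) * q j) = (\<Sum>j<?w. if j = k - ?d then q j else 0)"
      using Nent that False by (intro sum.cong) auto
    then show ?thesis using False that dims by simp
  qed (use Nent that in simp)
  have "?D *\<^sub>v x = ?D *\<^sub>v y \<longleftrightarrow> (\<forall>i<?d. (?D *\<^sub>v x) $ i = (?D *\<^sub>v y) $ i)"
    using dual_matrix_index(1)[of W] by (auto simp: vec_eq_iff)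
  also have "\<dots> \<longleftrightarrow> (\<forall>i<?d. x $ i - y $ i = (\<Sum>j<?w. of_int (W $$ (j, i)) * (x $ (?d + j) - y $ (?d + j))))"
    using xy dims by (auto simp: dual_matrix_mult_vec right_diff_distrib sum_subtractf)
  also have "\<dots> \<longleftrightarrow> (\<exists>\<phi>::'a \<Rightarrow> real. \<forall>k<?m. x $ k - y $ k = \<phi> (src (es ! k)) - \<phi> (tgt (es ! k)))"
    (is "?L \<longleftrightarrow> ?R")
  proof
    assume L: ?L
    define q where "q j = x $ (?d + j) - y $ (?d + j)" for j
    define \<phi> where "\<phi> u = (\<Sum>j<?w. of_int (P $$ (j, inv_into {..<?n} ((!) vs) u)) * q j)" for u
    have \<phi>: "\<phi> (vs ! v) = (\<Sum>j<?w. of_int (P $$ (j, v)) * q j)" if "v < ?n" for v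
      using that vs by (simp add: \<phi>_def inv_into_f_f inj_on_nth)
    have "x $ k - y $ k = \<phi> (src (es ! k)) - \<phi> (tgt (es ! k))" if k: "k < ?m" for k
    proof -
      have "x $ k - y $ k = (\<Sum>j<?w. of_int (?N $$ (j, k)) * q j)"
        unfolding colN[OF k] using L by (simp add: q_def)
      also have "\<dots> = (\<Sum>j<?w. (\<Sum>v<?n. of_int (P $$ (j, v)) * of_int (?A $$ (v, k))) * q j)"
        using index_mult_mat_sum[OF PQ(1) A _ k] PQ(3) by (intro sum.cong HOL.refl) simp
      also have "\<dots> = (\<Sum>v<?n. of_int (?A $$ (v, k)) * \<phi> (vs ! v))"
        by (simp add: \<phi> sum_distrib_left sum_distrib_right ac_simps) (rule sum.swap)
      also have "\<dots> = \<phi> (src (es ! k)) - \<phi> (tgt (es ! k))"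
        using bspec[OF es nth_mem[OF k]] vs k by (intro sum_incidence_column) auto
      finally show ?thesis .
    qed
    then show ?R by blast
  next
    assume ?R
    then obtain \<phi> :: "'a \<Rightarrow> real" where
      \<phi>: "\<And>k. k < ?m \<Longrightarrow> x $ k - y $ k = \<phi> (src (es ! k)) - \<phi> (tgt (es ! k))" by blast
    define q where "q j = (\<Sum>v<?n. of_int (Q $$ (v, j)) * \<phi> (vs ! v))" for j
    have eq: "x $ k - y $ k = (\<Sum>j<?w. of_int (?N $$ (j, k)) * q j)" if k: "k < ?m" for k
    proof -
      have "x $ k - y $ k = (\<Sum>v<?n. of_int (?A $$ (v, k)) * \<phi> (vs ! v))"
        unfolding \<phi>[OF k] using bspec[OF es nth_mem[OF k]] vs k by (intro sum_incidence_column[symmetric]) auto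
      also have "\<dots> = (\<Sum>v<?n. (\<Sum>j<?w. of_int (Q $$ (v, j)) * of_int (?N $$ (j, k))) * \<phi> (vs ! v))"
      proof (rule sum.cong[OF HOL.refl])
        fix v assume "v \<in> {..<?n}"
        then have "?A $$ (v, k) = (\<Sum>j<?w. Q $$ (v, j) * ?N $$ (j, k))"
          using index_mult_mat_sum[OF PQ(2) N _ k, of v] PQ(4) by simp
        then show "of_int (?A $$ (v, k)) * \<phi> (vs ! v) =
            (\<Sum>j<?w. of_int (Q $$ (v, j)) * of_int (?N $$ (j, k))) * \<phi> (vs ! v)" by simp
      qed
      also have "\<dots> = (\<Sum>j<?w. of_int (?N $$ (j, k)) * q j)"
        by (simp add: q_def sum_distrib_left sum_distrib_right ac_simps) (rule sum.swap)
      finally show ?thesis .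
    qed
    have "x $ (?d + j) - y $ (?d + j) = q j" if "j < ?w" for j
      using eq[of "?d + j"] colN[of "?d + j" q] that dims by simp
    then show ?L using eq colN dims by simp
  qed
  finally show ?thesis .
qed

section \<open>Lattice points of the tocyclotope\<close>

text \<open>Rounding down a potential keeps integral bounds on an integral vector plus its tension, since
  floor is monotone and commutes with integral shifts.\<close>

lemma floor_shifted_bounds:
  fixes z a b :: real and t :: int
  assumes "z \<in> \<int>" "0 \<le> z + a - b" "z + a - b \<le> of_int t"
  shows "0 \<le> \<lfloor>z\<rfloor> + \<lfloor>a\<rfloor> - \<lfloor>b\<rfloor>" "\<lfloor>z\<rfloor> + \<lfloor>a\<rfloor> - \<lfloor>b\<rfloor> \<le> t"
proof -
  obtain c where c: "z = of_int c" using assms(1) by (auto elim: Ints_cases)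
  have "b \<le> a + of_int c" using assms(2) c by simp
  then have "\<lfloor>b\<rfloor> \<le> \<lfloor>a + of_int c\<rfloor>" by (rule floor_mono)
  then show "0 \<le> \<lfloor>z\<rfloor> + \<lfloor>a\<rfloor> - \<lfloor>b\<rfloor>" using c by simp
  have "a \<le> b + of_int (t - c)" using assms(3) c by simp
  then have "\<lfloor>a\<rfloor> \<le> \<lfloor>b + of_int (t - c)\<rfloor>" by (rule floor_mono)
  then have "\<lfloor>a\<rfloor> \<le> \<lfloor>b\<rfloor> + (t - c)" by (simp only: floor_add_int[symmetric] floor_of_int)
  then show "\<lfloor>z\<rfloor> + \<lfloor>a\<rfloor> - \<lfloor>b\<rfloor> \<le> t" using c by simp
qed

context
  fixes vs :: "'a list" and es :: "'a set list" and src tgt :: "'a set \<Rightarrow> 'a" and W :: "int mat"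
  assumes net: "network_matrix (incidence_matrix vs es src tgt) W"
    and vs: "distinct vs" and es: "distinct es"
    and ends: "\<forall>e\<in>set es. src e \<in> set vs \<and> tgt e \<in> set vs \<and> src e \<noteq> tgt e"
begin

definition dual_point :: "('a set \<Rightarrow> int) \<Rightarrow> real Matrix.vec" where
  "dual_point x = map_mat real_of_int (dual_matrix W) *\<^sub>v Matrix.vec (length es) (\<lambda>k. of_int (x (es ! k)))"

lemma dim_W: "dim_col W + dim_row W = length es"
proof -
  have "incidence_matrix vs es src tgt \<in> carrier_mat (length vs) (length es)"
    by (simp add: incidence_matrix_def)
  then show ?thesis by (rule network_matrix_factors[OF net])
qed

lemma dual_matrix_carrier:
  "map_mat real_of_int (dual_matrix W) \<in> carrier_mat (dim_col W) (length es)"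
  using dual_matrix_index(1)[of W] dim_W by simp

lemma dual_point_in_dilate:
  assumes "t > 0" "x \<in> int_box t (set es)"
  shows "dual_point x \<in> lattice_points ((\<lambda>v. real t \<cdot>\<^sub>v v) ` zonotope (dual_matrix W))"
proof -
  let ?D = "map_mat real_of_int (dual_matrix W)"
  let ?v = "Matrix.vec (length es) (\<lambda>k. of_int (x (es ! k)) / real t)"
  have scale: "Matrix.vec (length es) (\<lambda>k. real_of_int (x (es ! k))) = real t \<cdot>\<^sub>v ?v"
    using assms(1) by (intro eq_vecI) auto
  have "dual_point x = real t \<cdot>\<^sub>v (?D *\<^sub>v ?v)"
    unfolding dual_point_def scale by (rule mult_mat_vec[OF dual_matrix_carrier]) simp
  moreover have "?D *\<^sub>v ?v \<in> zonotope (dual_matrix W)"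
    unfolding zonotope_def
  proof (intro CollectI exI conjI allI impI)
    show "?v \<in> carrier_vec (dim_col (dual_matrix W))" using dual_matrix_carrier by auto
    fix i assume "i < dim_col (dual_matrix W)"
    then have i: "i < length es" using dual_matrix_carrier by auto
    then have "0 \<le> x (es ! i)" "x (es ! i) \<le> int t" using assms(2) by (auto simp: int_box_def)
    then have "0 \<le> real_of_int (x (es ! i))" "real_of_int (x (es ! i)) \<le> real t" by linarith+
    then show "0 \<le> ?v $ i" "?v $ i \<le> 1" using i assms(1) by simp_all
  qed simp
  moreover have "dual_point x $ i \<in> \<int>" if "i < dim_vec (dual_point x)" for i
  proof -
    have "i < dim_col W" using that dual_matrix_carrier by (simp add: dual_point_def)
    then show ?thesis
      unfolding dual_point_def
      by (subst dual_matrix_mult_vec) (use dim_W in \<open>auto intro!: Ints_diff Ints_sum Ints_mult\<close>)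
  qed
  ultimately show ?thesis by (auto simp: lattice_points_def)
qed

text \<open>The lattice point \<open>p\<close> has two preimages: a real vector \<open>y\<close> in the cube, and the integral vector
  \<open>w = (p, 0)\<close>. They differ by a tension, and rounding its potential moves \<open>w\<close> into the cube.\<close>

lemma lattice_point_is_dual_point:
  assumes p: "p \<in> lattice_points ((\<lambda>v. real t \<cdot>\<^sub>v v) ` zonotope (dual_matrix W))"
  shows "p \<in> dual_point ` int_box t (set es)"
proof -
  let ?D = "map_mat real_of_int (dual_matrix W)" and ?m = "length es" and ?d = "dim_col W"
  obtain v where v: "v \<in> carrier_vec ?m" "\<And>k. k < ?m \<Longrightarrow> 0 \<le> v $ k \<and> v $ k \<le> 1" "p = real t \<cdot>\<^sub>v (?D *\<^sub>v v)"
    using p dual_matrix_carrier by (auto simp: lattice_points_def zonotope_def)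
  define y where "y = real t \<cdot>\<^sub>v v"
  have y: "y \<in> carrier_vec ?m" "\<And>k. k < ?m \<Longrightarrow> 0 \<le> y $ k \<and> y $ k \<le> real t"
    using v(1,2) by (auto simp: y_def mult_left_le)
  have pD: "p = ?D *\<^sub>v y"
    unfolding y_def v(3) using mult_mat_vec[OF dual_matrix_carrier v(1)] by simp
  have pc: "dim_vec p = ?d" unfolding pD using dual_matrix_carrier by simp
  then have pint: "p $ i \<in> \<int>" if "i < ?d" for i using p that by (simp add: lattice_points_def)
  \<comment> \<open>The identity block of the dual matrix gives the integral preimage \<open>(p, 0)\<close>.\<close>
  define w where "w = Matrix.vec ?m (\<lambda>k. if k < ?d then p $ k else 0)"
  have w: "w \<in> carrier_vec ?m" by (simp add: w_def)
  have "?D *\<^sub>v w = p"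
  proof (rule eq_vecI)
    fix i assume "i < dim_vec p"
    then have i: "i < ?d" using pc by simp
    have "w $ (?d + j) = 0" if "j < dim_row W" for j
      using that dim_W by (simp add: w_def)
    then show "(?D *\<^sub>v w) $ i = p $ i"
      using dual_matrix_mult_vec[OF _ i, of w] w i dim_W by (simp add: w_def)
  qed (use pc dual_matrix_carrier in simp)
  then have "?D *\<^sub>v y = ?D *\<^sub>v w" using pD by simp
  then obtain \<phi> :: "'a \<Rightarrow> real" where
    \<phi>: "\<forall>k<?m. y $ k - w $ k = \<phi> (src (es ! k)) - \<phi> (tgt (es ! k))"
    unfolding dual_matrix_kernel[OF net vs ends y(1) w] by blast
  define idx where "idx = inv_into {..<?m} ((!) es)"
  have idx: "idx (es ! k) = k" if "k < ?m" for k
    unfolding idx_def using that es by (intro inv_into_f_f) (auto intro: inj_on_nth)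
  define x where "x e = (if e \<in> set es then \<lfloor>w $ idx e\<rfloor> + \<lfloor>\<phi> (src e)\<rfloor> - \<lfloor>\<phi> (tgt e)\<rfloor> else 0)" for e
  have x: "x (es ! k) = \<lfloor>w $ k\<rfloor> + \<lfloor>\<phi> (src (es ! k))\<rfloor> - \<lfloor>\<phi> (tgt (es ! k))\<rfloor>" if "k < ?m" for k
    using that by (simp add: x_def idx)
  have wint: "w $ k \<in> \<int>" if "k < ?m" for k
    using that pint by (simp add: w_def)
  have "x \<in> int_box t (set es)"
    unfolding int_box_def
  proof (intro CollectI conjI ballI allI impI)
    fix e assume "e \<in> set es"
    then obtain k where k: "k < ?m" "e = es ! k" by (auto simp: in_set_conv_nth)
    have "y $ k - w $ k = \<phi> (src e) - \<phi> (tgt e)" using \<phi> k by blast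
    then have "y $ k = w $ k + \<phi> (src e) - \<phi> (tgt e)" by simp
    then show "0 \<le> x e" "x e \<le> int t"
      using floor_shifted_bounds[OF wint[OF k(1)], of "\<phi> (src e)" "\<phi> (tgt e)" "int t"] y(2)[OF k(1)] x[OF k(1)] k(2)
      by auto
  qed (simp add: x_def)
  moreover have "dual_point x = ?D *\<^sub>v w"
    unfolding dual_point_def
  proof (subst dual_matrix_kernel[OF net vs ends _ w])
    show "\<exists>\<phi>::'a \<Rightarrow> real. \<forall>k<?m. Matrix.vec ?m (\<lambda>k. of_int (x (es ! k))) $ k - w $ k =
        \<phi> (src (es ! k)) - \<phi> (tgt (es ! k))"
      using wint by (intro exI[of _ "\<lambda>v. of_int \<lfloor>\<phi> v\<rfloor>"]) (auto simp: x elim!: Ints_cases)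
  qed auto
  then have "p = dual_point x" using \<open>?D *\<^sub>v w = p\<close> by simp
  ultimately show ?thesis by blast
qed

text \<open>Integral vectors that differ by a real tension differ by an integral one, again by rounding the
  potential.\<close>

lemma dual_point_eq_iff:
  "dual_point x = dual_point y \<longleftrightarrow>
    (\<exists>\<phi>::'a \<Rightarrow> int. \<forall>e\<in>set es. x e - y e = \<phi> (src e) - \<phi> (tgt e))"
proof -
  have "dual_point x = dual_point y \<longleftrightarrow>
      (\<exists>\<phi>::'a \<Rightarrow> real. \<forall>k<length es. of_int (x (es ! k)) - of_int (y (es ! k)) = \<phi> (src (es ! k)) - \<phi> (tgt (es ! k)))"
    unfolding dual_point_def by (subst dual_matrix_kernel[OF net vs ends]) auto
  also have "\<dots> \<longleftrightarrow> (\<exists>\<phi>::'a \<Rightarrow> real. \<forall>e\<in>set es. of_int (x e) - of_int (y e) = \<phi> (src e) - \<phi> (tgt e))"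
    by (simp add: all_set_conv_all_nth)
  also have "\<dots> \<longleftrightarrow> (\<exists>\<phi>::'a \<Rightarrow> int. \<forall>e\<in>set es. x e - y e = \<phi> (src e) - \<phi> (tgt e))"
  proof
    assume "\<exists>\<phi>::'a \<Rightarrow> real. \<forall>e\<in>set es. of_int (x e) - of_int (y e) = \<phi> (src e) - \<phi> (tgt e)"
    then obtain \<phi> :: "'a \<Rightarrow> real" where \<phi>: "\<And>e. e \<in> set es \<Longrightarrow> of_int (x e) - of_int (y e) = \<phi> (src e) - \<phi> (tgt e)"
      by blast
    have "x e - y e = \<lfloor>\<phi> (src e)\<rfloor> - \<lfloor>\<phi> (tgt e)\<rfloor>" if "e \<in> set es" for e
    proof -
      have "\<phi> (src e) = \<phi> (tgt e) + of_int (x e - y e)" using \<phi>[OF that] by simp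
      then have "\<lfloor>\<phi> (src e)\<rfloor> = \<lfloor>\<phi> (tgt e)\<rfloor> + (x e - y e)" by (metis floor_add_int)
      then show ?thesis by simp
    qed
    then show "\<exists>\<phi>::'a \<Rightarrow> int. \<forall>e\<in>set es. x e - y e = \<phi> (src e) - \<phi> (tgt e)"
      by (intro exI[of _ "\<lambda>v. \<lfloor>\<phi> v\<rfloor>"] ballI)
  next
    assume "\<exists>\<phi>::'a \<Rightarrow> int. \<forall>e\<in>set es. x e - y e = \<phi> (src e) - \<phi> (tgt e)"
    then obtain \<phi> :: "'a \<Rightarrow> int" where "\<forall>e\<in>set es. x e - y e = \<phi> (src e) - \<phi> (tgt e)" by blast
    then show "\<exists>\<phi>::'a \<Rightarrow> real. \<forall>e\<in>set es. of_int (x e) - of_int (y e) = \<phi> (src e) - \<phi> (tgt e)"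
      by (intro exI[of _ "\<lambda>v. of_int (\<phi> v)"]) (simp flip: of_int_diff)
  qed
  finally show ?thesis .
qed

lemma lattice_points_dual_zonotope:
  assumes "t > 0"
  shows "finite (lattice_points ((\<lambda>v. real t \<cdot>\<^sub>v v) ` zonotope (dual_matrix W)))"
    and "card (lattice_points ((\<lambda>v. real t \<cdot>\<^sub>v v) ` zonotope (dual_matrix W))) =
      (\<Sum>S\<in>Pow (set es). if digraph.tension_free (set es) src tgt S then t ^ card S else 0)"
proof -
  interpret digraph "set es" src tgt by standard simp
  let ?L = "lattice_points ((\<lambda>v. real t \<cdot>\<^sub>v v) ` zonotope (dual_matrix W))"
  have L: "?L = dual_point ` int_box t (set es)"
    using dual_point_in_dilate[OF assms] lattice_point_is_dual_point by blast
  show "finite ?L" unfolding L by (intro finite_imageI finite_int_box) simp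
  have "card ?L = card (tension_class {} ` int_box t (set es))"
    unfolding L by (rule card_image_eq_if_same_kernel)
      (simp add: dual_point_eq_iff tension_class_eq_iff cong_tension_def)
  also have "\<dots> = (\<Sum>S\<in>Pow (set es). if tension_free S then t ^ card S else 0)"
    using card_tension_classes[of "set es" "{}" t] by (simp add: tension_free_def)
  finally show "card ?L = (\<Sum>S\<in>Pow (set es). if tension_free S then t ^ card S else 0)" .
qed

end

lemma orientation_ends:
  assumes "simple_graph V E" "orientation E src tgt" "f \<in> E"
  shows "{src f, tgt f} = f" "src f \<in> V" "tgt f \<in> V" "src f \<noteq> tgt f"
proof -
  have "f \<subseteq> V" "card f = 2" using assms(1,3) by (simp_all add: simple_graph_def)
  show f: "{src f, tgt f} = f"
    using bspec[OF assms(2)[unfolded orientation_def] assms(3)] by (rule sym)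
  with \<open>f \<subseteq> V\<close> show "src f \<in> V" "tgt f \<in> V" by blast+
  show "src f \<noteq> tgt f"
  proof
    assume "src f = tgt f"
    then have "card {src f, tgt f} = 1" by simp
    with f \<open>card f = 2\<close> show False by simp
  qed
qed

lemma reach_imp_equal_potential:
  assumes "(u, v) \<in> reach (graph_of V E) S" "simple_graph V E" "orientation E src tgt" "S \<subseteq> E"
    and "\<And>f. f \<in> S \<Longrightarrow> \<phi> (src f) = \<phi> (tgt f)"
  shows "\<phi> u = \<phi> v"
  using assms(1)
proof (induction rule: rtrancl_induct)
  case (step x y)
  then have f: "{x, y} \<in> S" by (simp add: adj_rel_edge_subgraph_graph_of)
  define e where "e = {x, y}"
  have e: "e \<in> S" "{src e, tgt e} = {x, y}"
    using f orientation_ends(1)[OF assms(2,3)] assms(4) by (auto simp: e_def)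
  from e(2) have "src e = x \<and> tgt e = y \<or> src e = y \<and> tgt e = x" by (simp only: doubleton_eq_iff)
  moreover have "\<phi> (src e) = \<phi> (tgt e)" using e(1) by (rule assms(5))
  ultimately have "\<phi> x = \<phi> y" by (elim disjE conjE) simp_all
  with step.IH show ?case by simp
qed simp

text \<open>A potential is constant on the components of \<open>E - S\<close> iff its tension is supported on \<open>S\<close>, and all
  its tension vanishes iff it is constant on the connected graph. If \<open>E - S\<close> is disconnected, the
  indicator function of a component gives a nonzero tension.\<close>

lemma tension_free_iff_connected:
  assumes simple: "simple_graph V E" and con: "graph_connected (graph_of V E)"
    and ori: "orientation E src tgt" and "finite E"
  shows "digraph.tension_free E src tgt S \<longleftrightarrow> graph_connected (edge_subgraph (graph_of V E) (E - S))"
proof -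
  interpret digraph E src tgt by standard fact
  let ?G = "graph_of V E"
  have G: "verts ?G = V" "edge_subgraph ?G E = ?G" by (simp_all add: graph_of_def edge_subgraph_def)
  note ends = orientation_ends[OF simple ori]
  have reachE: "(u, v) \<in> reach ?G E" if "u \<in> V" "v \<in> V" for u v
    using con that G by (simp add: graph_connected_def)
  show ?thesis
  proof
    assume free: "tension_free S"
    show "graph_connected (edge_subgraph ?G (E - S))"
      unfolding graph_connected_edge_subgraph G
    proof (intro conjI ballI)
      show "V \<noteq> {}" using con G by (simp add: graph_connected_def)
      fix u v assume uv: "u \<in> V" "v \<in> V"
      define \<phi> :: "'a \<Rightarrow> int" where "\<phi> w = (if (u, w) \<in> reach ?G (E - S) then 1 else 0)" for w
      have "\<phi> (src f) = \<phi> (tgt f)" if f: "f \<in> E - S" for f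
      proof -
        have "(src f, tgt f) \<in> reach ?G (E - S)"
          using ends[of f] f by (intro r_into_rtrancl) (simp add: adj_rel_edge_subgraph_graph_of)
        then have "(u, src f) \<in> reach ?G (E - S) \<longleftrightarrow> (u, tgt f) \<in> reach ?G (E - S)"
          by (meson reach_sym rtrancl_trans)
        then show ?thesis by (simp add: \<phi>_def)
      qed
      then have "\<forall>f\<in>E. \<phi> (src f) = \<phi> (tgt f)"
        using free unfolding tension_free_def by blast
      then have "\<phi> u = \<phi> v"
        using reach_imp_equal_potential[OF reachE[OF uv] simple ori subset_refl, of \<phi>] by blast
      then show "(u, v) \<in> reach ?G (E - S)" by (simp add: \<phi>_def split: if_splits)
    qed
  next
    assume con': "graph_connected (edge_subgraph ?G (E - S))"
    show "tension_free S"
      unfolding tension_free_def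
    proof (intro allI impI ballI)
      fix \<phi> :: "'a \<Rightarrow> int" and f
      assume \<phi>: "\<forall>f\<in>E - S. \<phi> (src f) = \<phi> (tgt f)" and f: "f \<in> E"
      have "(src f, tgt f) \<in> reach ?G (E - S)"
        using con' ends[OF f] unfolding graph_connected_edge_subgraph G by blast
      then show "\<phi> (src f) = \<phi> (tgt f)"
        by (rule reach_imp_equal_potential[where \<phi>=\<phi>, OF _ simple ori Diff_subset])
          (use \<phi> in blast)
    qed
  qed
qed

section \<open>The Ehrhart polynomial and planar duality\<close>

theorem theorem3p1:
  fixes V :: "'a set" and E :: "'a set set" and n m :: nat
    and src tgt :: "'a set \<Rightarrow> 'a"
    and vs :: "'a list" and bs ts :: "'a set list"
    and W :: "int mat"
  assumes "simple_graph V E"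
    and "graph_connected (graph_of V E)"
    and "n = card V" and "m = card E"
    and "orientation E src tgt"
    and "distinct vs" and "set vs = V"
    and "distinct (bs @ ts)" and "set (bs @ ts) = E"
    and "spanning_tree (graph_of V E) (set ts)"
    and "network_matrix (incidence_matrix vs (bs @ ts) src tgt) W"
  shows "is_ehrhart_polynomial (zonotope (dual_matrix W))
           (\<Sum>k=0..m + 1 - n. monom (real (num_spanning_complements (graph_of V E) k)) k) \<and>
         (\<forall>pos \<gamma>. planar_embedding V E pos \<gamma> \<longrightarrow>
           (\<forall>k. num_spanning_complements (graph_of V E) k = num_forests (dual_graph V E pos \<gamma>) k))"
proof
  let ?G = "graph_of V E"
  have G: "verts ?G = V" "edges ?G = E" by (simp_all add: graph_of_def)
  have finV: "finite V" using assms(1) by (simp add: simple_graph_def)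
  have finE: "finite E" unfolding assms(9)[symmetric] by simp
  let ?con = "\<lambda>S. graph_connected (edge_subgraph ?G (E - S))"
  have num: "num_spanning_complements ?G k = card {D \<in> {D. D \<subseteq> E \<and> ?con D}. card D = k}" for k
    using num_spanning_complements_eq[of ?G k] finE by (simp add: G conj_assoc)
  have small: "card D \<le> m + 1 - n" if "D \<subseteq> E" "?con D" for D
  proof -
    have "n \<le> Suc (card (E - D))"
      using connected_card_verts_le[OF that(2)] finV finE by (simp add: G assms(3))
    moreover have "card (E - D) = m - card D" "card D \<le> m"
      using that(1) finE by (simp_all add: assms(4) card_Diff_subset finite_subset card_mono)
    ultimately show ?thesis by linarith
  qed
  have ends: "\<forall>e\<in>set (bs @ ts). src e \<in> set vs \<and> tgt e \<in> set vs \<and> src e \<noteq> tgt e"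
  proof
    fix e assume "e \<in> set (bs @ ts)"
    then have "e \<in> E" unfolding assms(9) .
    from orientation_ends[OF assms(1,5) this]
    show "src e \<in> set vs \<and> tgt e \<in> set vs \<and> src e \<noteq> tgt e" by (simp add: assms(7))
  qed
  show "is_ehrhart_polynomial (zonotope (dual_matrix W))
      (\<Sum>k=0..m + 1 - n. monom (real (num_spanning_complements ?G k)) k)"
    unfolding is_ehrhart_polynomial_def
  proof (intro allI impI conjI)
    fix t :: nat assume t: "t > 0"
    let ?L = "lattice_points ((\<lambda>v. real t \<cdot>\<^sub>v v) ` zonotope (dual_matrix W))"
    show "finite ?L"
      by (rule lattice_points_dual_zonotope(1)[OF assms(11,6,8) ends t])
    have "card ?L = (\<Sum>S\<in>Pow E. if ?con S then t ^ card S else 0)"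
      using lattice_points_dual_zonotope(2)[OF assms(11,6,8) ends t]
      unfolding assms(9) tension_free_iff_connected[OF assms(1,2,5) finE] .
    also have "\<dots> = (\<Sum>S\<in>{D. D \<subseteq> E \<and> ?con D}. t ^ card S)"
      using finE by (simp add: sum.inter_filter[symmetric] Pow_def)
    also have "\<dots> = (\<Sum>k=0..m + 1 - n. \<Sum>S\<in>{D \<in> {D. D \<subseteq> E \<and> ?con D}. card D = k}. t ^ card S)"
      using finE small by (intro sum.group[symmetric]) auto
    also have "\<dots> = (\<Sum>k=0..m + 1 - n. num_spanning_complements ?G k * t ^ k)"
      unfolding num by (intro sum.cong HOL.refl) simp
    finally show "poly (\<Sum>k=0..m + 1 - n. monom (real (num_spanning_complements ?G k)) k) (real t) = real (card ?L)"
      by (simp add: poly_sum poly_monom)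
  qed
  show "\<forall>pos \<gamma>. planar_embedding V E pos \<gamma> \<longrightarrow>
      (\<forall>k. num_spanning_complements ?G k = num_forests (dual_graph V E pos \<gamma>) k)"
  proof (intro allI impI)
    fix pos \<gamma> k assume "planar_embedding V E pos \<gamma>"
    then interpret plane_graph V E pos \<gamma> using assms(1) by unfold_locales
    have "{D \<in> {D. D \<subseteq> E \<and> ?con D}. card D = k} =
        {S. S \<subseteq> edges dual \<and> card S = k \<and> is_forest (edge_subgraph dual S)}"
      using dual_forest_iff_complement_connected[OF assms(2)] by (auto simp: dual_graph_def)
    then show "num_spanning_complements ?G k = num_forests dual k"
      by (simp add: num num_forests_def)
  qed
qed

end
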